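(* Let $X$ be an operator space generating a TRO $T$. If $\theta:T\to B(H,K)$ is a weak boundary representation for $X$, then the corresponding representation $\omega$ of $C^*(\mathcal S(X))$ on $K\oplus H$ is a weak boundary representation for the Paulsen system $\mathcal S(X)$.
   Context: A ternary ring of operators (TRO) is a norm closed subspace $T\subset B(H_0,K_0)$ with $xy^*z\in T$ for all $x,y,z\in T$. A triple morphism (representation of $T$) is a linear map $\theta:T\to B(H,K)$ with $\theta(xy^*z)=\theta(x)\theta(y)^*\theta(z)$. It is irreducible if, whenever $p\in B(H)$, $q\in B(K)$ are projections with $q\theta(t)=\theta(t)p$ for all $t\in T$, either $p=0,q=0$ or $p=1,q=1$. For $X\subset T\subset B(H_0,K_0)$, the Paulsen system is $\mathcal S(X)=\left\{\begin{bmatrix} \lambda I_{K_0} & x \\ y^* & \mu I_{H_0} \end{bmatrix}:x,y\in X,\ \lambda,\mu\in\mathbb C\right\}\subset B(K_0\oplus H_0)$, and $C^*(\mathcal S(X))$ is the $C^*$-algebra it generates, whose elements have the form $\begin{bmatrix} a+\lambda I_{K_0} & x \\ y^* & b+\mu I_{H_0} \end{bmatrix}$ with $a\in TT^*=\overline{\mathrm{lin}}\{xy^*:x,y\in T\}$, $b\in T^*T=\overline{\mathrm{lin}}\{x^*y:x,y\in T\}$, $x,y\in T$, $\lambda,\mu\in\mathbb C$. The representation $\omega$ of $C^*(\mathcal S(X))$ corresponding to a representation $\theta$ of $T$ is the unital $*$-representation $\omega=\begin{bmatrix} \omega_1 & \theta \\ \theta^* & \omega_2 \end{bmatrix}$ on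 $K\oplus H$ with $\omega_1(xy^* )=\theta(x)\theta(y)^*$, $\omega_2(x^*y)=\theta(x)^*\theta(y)$ for $x,y\in T$, and $\omega\begin{bmatrix} \lambda I_{K_0} & x \\ y^* & \mu I_{H_0} \end{bmatrix}=\begin{bmatrix} \lambda I_K & \theta(x) \\ \theta(y)^* & \mu I_H \end{bmatrix}$. Weak boundary representation for an operator space: an irreducible triple morphism $\psi:T\to B(H,K)$ is a weak boundary representation for $X$ if $\psi|_X$ has a unique extension of the form $v^*\psi u$, namely $\psi$ itself, where $u:H\to H$ and $v:K\to K$ are isometries; that is, whenever $u,v$ are such isometries with $v^*\psi(x)u=\psi(x)$ for all $x\in X$, then $v^*\psi(t)u=\psi(t)$ for all $t\in T$. Weak boundary representation for an operator system $S$: an irreducible $*$-representation $\omega:C^*(S)\to B(L)$ such that whenever $V:L\to L$ is an isometry with $V^*\omega(s)V=\omega(s)$ for all $s\in S$, then $V^*\omega(a)V=\omega(a)$ for all $a\in C^*(S)$. *)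

theory Defs
  imports "HOL-Analysis.Analysis"
begin

section \<open>Complex Hilbert spaces\<close>

class scaleC =
  fixes scaleC :: "complex \<Rightarrow> 'a \<Rightarrow> 'a"  (infixr "*\<^sub>C" 75)

class complex_vector = real_vector + scaleC +
  assumes scaleC_add_right: "c *\<^sub>C (x + y) = c *\<^sub>C x + c *\<^sub>C y"
    and scaleC_add_left: "(c + d) *\<^sub>C x = c *\<^sub>C x + d *\<^sub>C x"
    and scaleC_scaleC: "c *\<^sub>C d *\<^sub>C x = (c * d) *\<^sub>C x"
    and scaleR_scaleC: "scaleR r x = complex_of_real r *\<^sub>C x"

interpretation complex_vector: vector_space "scaleC :: complex \<Rightarrow> 'a \<Rightarrow> 'a::complex_vector"
proof
  fix x :: 'a
  show "1 *\<^sub>C x = x"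
    using scaleR_scaleC[of 1 x] by simp
qed (simp_all add: scaleC_add_right scaleC_add_left scaleC_scaleC)

text \<open>The complex inner product is linear in its first argument; its real part is the real inner
  product, which determines the norm. The zero space is allowed.\<close>

class complex_hilbert = complex_vector + real_inner + complete_space +
  fixes cinner :: "'a \<Rightarrow> 'a \<Rightarrow> complex"
  assumes cinner_commute: "cinner x y = cnj (cinner y x)"
    and cinner_add_left: "cinner (x + y) z = cinner x z + cinner y z"
    and cinner_scaleC_left: "cinner (c *\<^sub>C x) y = c * cinner x y"
    and inner_eq_Re_cinner: "inner x y = Re (cinner x y)"

lemma cinner_scaleC_right: "cinner x (c *\<^sub>C y) = cnj c * cinner x y"
  by (metis cinner_commute cinner_scaleC_left complex_cnj_mult)

lemma Im_cinner: "Im (cinner x y) = - inner (\<i> *\<^sub>C x) y"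
  by (simp add: inner_eq_Re_cinner cinner_scaleC_left)

lemma norm_scaleC: "norm (c *\<^sub>C x) = cmod c * norm (x :: 'a::complex_hilbert)"
proof -
  have "inner (c *\<^sub>C x) (c *\<^sub>C x) = Re (c * cnj c * cinner x x)"
    by (simp add: inner_eq_Re_cinner cinner_scaleC_left cinner_scaleC_right mult.assoc mult.left_commute)
  also have "\<dots> = (cmod c)\<^sup>2 * inner x x"
    by (simp add: complex_norm_square[symmetric] inner_eq_Re_cinner flip: of_real_power)
  finally show ?thesis
    by (simp add: norm_eq_sqrt_inner real_sqrt_mult)
qed

lemma bounded_linear_scaleC: "bounded_linear (\<lambda>x :: 'a::complex_hilbert. c *\<^sub>C x)"
proof (rule bounded_linear_intro)
  fix r :: real and x :: 'a
  show "c *\<^sub>C r *\<^sub>R x = r *\<^sub>R c *\<^sub>C x"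
    by (simp add: scaleR_scaleC scaleC_scaleC mult.commute)
  show "norm (c *\<^sub>C x) \<le> norm x * cmod c"
    by (simp add: norm_scaleC)
qed (simp add: scaleC_add_right)

text \<open>The Hilbert space direct sum of two Hilbert spaces is the product type: the library's norm on
  pairs is the Euclidean one.\<close>

instantiation prod :: (complex_hilbert, complex_hilbert) complex_hilbert
begin

definition scaleC_prod :: "complex \<Rightarrow> 'a \<times> 'b \<Rightarrow> 'a \<times> 'b"
  where "c *\<^sub>C x = (c *\<^sub>C fst x, c *\<^sub>C snd x)"

definition cinner_prod :: "'a \<times> 'b \<Rightarrow> 'a \<times> 'b \<Rightarrow> complex"
  where "cinner x y = cinner (fst x) (fst y) + cinner (snd x) (snd y)"

instance
proof
  fix c d :: complex and r :: real and x y z :: "'a \<times> 'b"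
  show "cinner x y = cnj (cinner y x)"
    unfolding cinner_prod_def
    by (metis cinner_commute complex_cnj_add)
qed (auto simp: scaleC_prod_def cinner_prod_def inner_prod_def scaleC_add_right scaleC_add_left
      scaleC_scaleC scaleR_scaleC cinner_add_left cinner_scaleC_left inner_eq_Re_cinner
      algebra_simps prod_eq_iff)

end


section \<open>Bounded operators\<close>

instantiation blinfun :: (real_normed_vector, complex_hilbert) complex_vector
begin

lift_definition scaleC_blinfun :: "complex \<Rightarrow> 'a \<Rightarrow>\<^sub>L 'b \<Rightarrow> 'a \<Rightarrow>\<^sub>L 'b" is "\<lambda>c f x. c *\<^sub>C f x"
  by (rule bounded_linear_compose[OF bounded_linear_scaleC])

instance
  by standard (transfer; simp add: scaleC_add_right scaleC_add_left scaleC_scaleC scaleR_scaleC)+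

end

lemma blinfun_apply_scaleC [simp]: "blinfun_apply (c *\<^sub>C A) x = c *\<^sub>C blinfun_apply A x"
  by transfer simp

text \<open>The type \<^typ>\<open>'a \<Rightarrow>\<^sub>L 'b\<close> consists of the bounded real-linear maps. The space \<open>B(H,K)\<close> is the set
  of those that are complex linear, with the operator norm of the type.\<close>

definition bops :: "('a::complex_hilbert \<Rightarrow>\<^sub>L 'b::complex_hilbert) set"
  where "bops = {A :: 'a \<Rightarrow>\<^sub>L 'b. \<forall>c x. A (c *\<^sub>C x) = c *\<^sub>C A x}"

definition adj :: "('a::complex_hilbert \<Rightarrow>\<^sub>L 'b::complex_hilbert) \<Rightarrow> 'b \<Rightarrow>\<^sub>L 'a"  ("_\<^sup>\<star>" [1000] 1000)
  where "A\<^sup>\<star> = (THE B :: 'b \<Rightarrow>\<^sub>L 'a. \<forall>x y. cinner (A x) y = cinner x (B y))"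

definition isometry :: "('a::complex_hilbert \<Rightarrow>\<^sub>L 'b::complex_hilbert) \<Rightarrow> bool"
  where "isometry V \<longleftrightarrow> V \<in> bops \<and> (\<forall>x. norm (V x) = norm x)"

definition projection :: "('a::complex_hilbert \<Rightarrow>\<^sub>L 'a) \<Rightarrow> bool"
  where "projection p \<longleftrightarrow> p \<in> bops \<and> p o\<^sub>L p = p \<and> p\<^sup>\<star> = p"

lift_definition block ::
  "('k::complex_hilbert \<Rightarrow>\<^sub>L 'k) \<Rightarrow> ('h::complex_hilbert \<Rightarrow>\<^sub>L 'k) \<Rightarrow> ('k \<Rightarrow>\<^sub>L 'h) \<Rightarrow> ('h \<Rightarrow>\<^sub>L 'h)
    \<Rightarrow> ('k \<times> 'h) \<Rightarrow>\<^sub>L ('k \<times> 'h)"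
  is "\<lambda>a x z b p. (a (fst p) + x (snd p), z (fst p) + b (snd p))"
  by (intro bounded_linear_Pair bounded_linear_add
      bounded_linear_compose[OF _ bounded_linear_fst] bounded_linear_compose[OF _ bounded_linear_snd])

lemma block_apply: "block a x z b (k, h) = (a k + x h, z k + b h)"
  by transfer simp


subsection \<open>Existence of adjoints\<close>

lemma riesz_representation:
  fixes f :: "'a::{real_inner, complete_space} \<Rightarrow> real"
  assumes "bounded_linear f"
  shows "\<exists>z. \<forall>x. f x = inner z x"
proof -
  interpret f: bounded_linear f by fact
  obtain C where C: "\<And>x. \<bar>f x\<bar> \<le> norm x * C"
    using f.bounded by auto
  define F where "F = (\<lambda>x. (norm x)\<^sup>2 - 2 * f x)"
  define m where "m = Inf (range F)"
  have lower: "- C\<^sup>2 \<le> F x" for x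
  proof -
    have "f x \<le> norm x * C"
      using C[of x] by linarith
    moreover have "0 \<le> (norm x - C)\<^sup>2"
      by simp
    ultimately show ?thesis
      unfolding F_def by (simp add: power2_diff)
  qed
  then have bdd: "bdd_below (range F)"
    by (meson bdd_belowI2)
  then have m_le: "m \<le> F x" for x
    unfolding m_def by (simp add: cInf_lower)
  have "\<exists>x. F x < m + 1 / Suc n" for n
    using cInf_less_iff[OF _ bdd, of "m + 1 / Suc n"] unfolding m_def by auto
  then obtain X where X: "\<And>n. F (X n) < m + 1 / Suc n"
    by metis
  have par: "(norm (a - b))\<^sup>2 = 2 * (F a + F b - 2 * F ((1/2) *\<^sub>R (a + b)))" for a b
    unfolding F_def
    by (simp add: power2_norm_eq_inner f.scaleR f.add algebra_simps inner_commute)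
  have "Cauchy X"
  proof (rule CauchyI)
    fix e :: real
    assume "0 < e"
    then obtain N where N: "4 / e\<^sup>2 < real N"
      using reals_Archimedean2 by blast
    have "norm (X n - X k) < e" if "N \<le> n" "N \<le> k" for n k
    proof -
      have "1 / Suc i < e\<^sup>2 / 4" if "N \<le> i" for i
      proof -
        have "4 / e\<^sup>2 < Suc i"
          using N that by linarith
        then show ?thesis
          using \<open>0 < e\<close> by (simp add: field_simps)
      qed
      then have "F (X n) < m + e\<^sup>2 / 4" "F (X k) < m + e\<^sup>2 / 4"
        using X[of n] X[of k] that by (smt (verit))+
      then have "(norm (X n - X k))\<^sup>2 < e\<^sup>2"
        unfolding par[of "X n" "X k"]
        using m_le[of "(1/2) *\<^sub>R (X n + X k)"] by (simp add: field_simps)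
      then show ?thesis
        using \<open>0 < e\<close> power_less_imp_less_base by fastforce
    qed
    then show "\<exists>M. \<forall>m\<ge>M. \<forall>n\<ge>M. norm (X m - X n) < e"
      by blast
  qed
  then obtain z where z: "X \<longlonglongrightarrow> z"
    using Cauchy_convergent convergent_def by blast
  have "(\<lambda>n. F (X n)) \<longlonglongrightarrow> F z"
    unfolding F_def by (intro tendsto_intros f.tendsto z)
  moreover have "(\<lambda>n. m + 1 / Suc n) \<longlonglongrightarrow> m + 0"
    by (intro tendsto_intros LIMSEQ_Suc[OF lim_1_over_n])
  ultimately have "F z \<le> m + 0"
    using X by (intro LIMSEQ_le) (auto intro: less_imp_le)
  then have min: "F z \<le> F x" for x
    using m_le[of x] by linarith
  have "f x = inner z x" for x
  proof (rule ccontr)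
    assume "f x \<noteq> inner z x"
    define d where "d = inner z x - f x"
    define q where "q = 1 + inner x x"
    define t where "t = - d / q"
    have pos: "0 < q"
      unfolding q_def by (simp add: add_pos_nonneg)
    have "F (z + t *\<^sub>R x) = F z + 2 * t * d + t\<^sup>2 * inner x x"
      unfolding F_def d_def power2_norm_eq_inner
      by (simp add: f.scaleR f.add algebra_simps inner_commute power2_eq_square)
    then have "0 \<le> 2 * t * d + t\<^sup>2 * inner x x"
      using min[of "z + t *\<^sub>R x"] by linarith
    also have "\<dots> \<le> 2 * t * d + t\<^sup>2 * q"
      by (simp add: q_def algebra_simps)
    also have "\<dots> = - d\<^sup>2 / q"
      using pos unfolding t_def by (simp add: power2_eq_square field_simps)
    also have "\<dots> < 0"
      using pos \<open>f x \<noteq> inner z x\<close> by (simp add: d_def)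
    finally show False by simp
  qed
  then show ?thesis by blast
qed

lemma adjoint_unique:
  fixes B C :: "'b::complex_hilbert \<Rightarrow>\<^sub>L 'a::complex_hilbert"
  assumes "\<forall>x y. cinner x (B y) = cinner x (C y)"
  shows "B = C"
proof (rule blinfun_eqI)
  fix y
  have "inner x (B y) = inner x (C y)" for x
    using assms by (simp add: inner_eq_Re_cinner)
  then show "B y = C y"
    by (metis inner_commute vector_eq_rdot)
qed

lemma adjoint_exists:
  fixes A :: "'a::complex_hilbert \<Rightarrow>\<^sub>L 'b::complex_hilbert"
  assumes "A \<in> bops"
  shows "\<exists>B :: 'b \<Rightarrow>\<^sub>L 'a. \<forall>x y. cinner (A x) y = cinner x (B y)"
proof -
  have "\<exists>z. \<forall>x. inner (A x) y = inner z x" for y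
    by (intro riesz_representation bounded_linear_compose[OF bounded_linear_inner_left]
        blinfun.bounded_linear_right)
  then obtain g where "\<And>y x. inner (A x) y = inner (g y) x"
    by metis
  then have g: "inner (A x) y = inner x (g y)" for x y
    by (simp add: inner_commute)
  have eqI: "u = v" if "\<And>x. inner x u = inner x v" for u v :: 'a
    using that by (metis inner_commute vector_eq_rdot)
  have "bounded_linear g"
  proof (rule bounded_linear_intro)
    show "g (x + y) = g x + g y" for x y
      by (rule eqI) (simp add: inner_add_right flip: g)
    show "g (r *\<^sub>R x) = r *\<^sub>R g x" for r x
      by (rule eqI) (simp flip: g)
    show "norm (g y) \<le> norm y * norm A" for y
    proof -
      have "(norm (g y))\<^sup>2 = inner (A (g y)) y"
        by (simp add: power2_norm_eq_inner g)
      also have "\<dots> \<le> norm A * norm (g y) * norm y"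
        by (meson mult_right_mono norm_blinfun norm_cauchy_schwarz norm_ge_zero order_trans)
      finally show ?thesis
        by (cases "g y = 0") (auto simp: power2_eq_square mult.commute mult.left_commute)
    qed
  qed
  then have "blinfun_apply (Blinfun g) = g"
    by (rule bounded_linear_Blinfun_apply)
  moreover have "cinner (A x) y = cinner x (g y)" for x y
  proof (rule complex_eqI)
    show "Re (cinner (A x) y) = Re (cinner x (g y))"
      using g by (simp add: inner_eq_Re_cinner)
    have "\<i> *\<^sub>C A x = A (\<i> *\<^sub>C x)"
      using assms by (simp add: bops_def)
    then show "Im (cinner (A x) y) = Im (cinner x (g y))"
      using g by (simp add: Im_cinner)
  qed
  ultimately show ?thesis
    by metis
qed

lemma cinner_adj:
  fixes A :: "'a::complex_hilbert \<Rightarrow>\<^sub>L 'b::complex_hilbert"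
  assumes "A \<in> bops"
  shows "cinner (A x) y = cinner x (A\<^sup>\<star> y)"
proof -
  have "\<exists>!B :: 'b \<Rightarrow>\<^sub>L 'a. \<forall>x y. cinner (A x) y = cinner x (B y)"
    using adjoint_exists[OF assms] by (metis adjoint_unique)
  from theI'[OF this] show ?thesis
    unfolding adj_def by blast
qed


section \<open>Operator spaces, ternary rings of operators, triple morphisms\<close>

text \<open>Operator spaces are not required to be norm closed.\<close>

definition operator_space :: "('h::complex_hilbert \<Rightarrow>\<^sub>L 'k::complex_hilbert) set \<Rightarrow> bool"
  where "operator_space X \<longleftrightarrow> X \<subseteq> bops \<and> complex_vector.subspace X"

definition tro :: "('h::complex_hilbert \<Rightarrow>\<^sub>L 'k::complex_hilbert) set \<Rightarrow> bool"
  where "tro T \<longleftrightarrow> T \<subseteq> bops \<and> complex_vector.subspace T \<and> closed T \<and>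
    (\<forall>x\<in>T. \<forall>y\<in>T. \<forall>z\<in>T. x o\<^sub>L y\<^sup>\<star> o\<^sub>L z \<in> T)"

definition clinear_on ::
  "'a::complex_vector set \<Rightarrow> ('a \<Rightarrow> 'b::complex_vector) \<Rightarrow> bool"
  where "clinear_on A f \<longleftrightarrow>
    (\<forall>x\<in>A. \<forall>y\<in>A. f (x + y) = f x + f y) \<and> (\<forall>c. \<forall>x\<in>A. f (c *\<^sub>C x) = c *\<^sub>C f x)"

definition triple_morphism ::
  "('h0::complex_hilbert \<Rightarrow>\<^sub>L 'k0::complex_hilbert) set
    \<Rightarrow> (('h0 \<Rightarrow>\<^sub>L 'k0) \<Rightarrow> ('h::complex_hilbert \<Rightarrow>\<^sub>L 'k::complex_hilbert)) \<Rightarrow> bool"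
  where "triple_morphism T \<theta> \<longleftrightarrow> \<theta> ` T \<subseteq> bops \<and> clinear_on T \<theta> \<and>
    (\<forall>x\<in>T. \<forall>y\<in>T. \<forall>z\<in>T. \<theta> (x o\<^sub>L y\<^sup>\<star> o\<^sub>L z) = \<theta> x o\<^sub>L (\<theta> y)\<^sup>\<star> o\<^sub>L \<theta> z)"

definition irreducible_triple_morphism ::
  "('h0::complex_hilbert \<Rightarrow>\<^sub>L 'k0::complex_hilbert) set
    \<Rightarrow> (('h0 \<Rightarrow>\<^sub>L 'k0) \<Rightarrow> ('h::complex_hilbert \<Rightarrow>\<^sub>L 'k::complex_hilbert)) \<Rightarrow> bool"
  where "irreducible_triple_morphism T \<theta> \<longleftrightarrow> triple_morphism T \<theta> \<and>
    (\<forall>p q. projection p \<and> projection q \<and> (\<forall>t\<in>T. q o\<^sub>L \<theta> t = \<theta> t o\<^sub>L p) \<longrightarrow>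
      p = 0 \<and> q = 0 \<or> p = id_blinfun \<and> q = id_blinfun)"

definition weak_boundary_triple_morphism ::
  "('h0::complex_hilbert \<Rightarrow>\<^sub>L 'k0::complex_hilbert) set \<Rightarrow> ('h0 \<Rightarrow>\<^sub>L 'k0) set
    \<Rightarrow> (('h0 \<Rightarrow>\<^sub>L 'k0) \<Rightarrow> ('h::complex_hilbert \<Rightarrow>\<^sub>L 'k::complex_hilbert)) \<Rightarrow> bool"
  where "weak_boundary_triple_morphism X T \<psi> \<longleftrightarrow> irreducible_triple_morphism T \<psi> \<and>
    (\<forall>u v. isometry u \<and> isometry v \<and> (\<forall>x\<in>X. v\<^sup>\<star> o\<^sub>L \<psi> x o\<^sub>L u = \<psi> x) \<longrightarrow>
      (\<forall>t\<in>T. v\<^sup>\<star> o\<^sub>L \<psi> t o\<^sub>L u = \<psi> t))"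


section \<open>Operator systems and representations of the generated C*-algebra\<close>

definition cstar_algebra :: "('l::complex_hilbert \<Rightarrow>\<^sub>L 'l) set \<Rightarrow> bool"
  where "cstar_algebra A \<longleftrightarrow> A \<subseteq> bops \<and> complex_vector.subspace A \<and> closed A \<and>
    (\<forall>a\<in>A. \<forall>b\<in>A. a o\<^sub>L b \<in> A) \<and> (\<forall>a\<in>A. a\<^sup>\<star> \<in> A)"

text \<open>No unit is adjoined here: operator systems contain the identity.\<close>

definition cstar_generated :: "('l::complex_hilbert \<Rightarrow>\<^sub>L 'l) set \<Rightarrow> ('l \<Rightarrow>\<^sub>L 'l) set"
  where "cstar_generated S = cstar_algebra hull S"

definition star_representation ::
  "('l0::complex_hilbert \<Rightarrow>\<^sub>L 'l0) set
    \<Rightarrow> (('l0 \<Rightarrow>\<^sub>L 'l0) \<Rightarrow> ('l::complex_hilbert \<Rightarrow>\<^sub>L 'l)) \<Rightarrow> bool"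
  where "star_representation A \<omega> \<longleftrightarrow> \<omega> ` A \<subseteq> bops \<and> clinear_on A \<omega> \<and>
    (\<forall>a\<in>A. \<forall>b\<in>A. \<omega> (a o\<^sub>L b) = \<omega> a o\<^sub>L \<omega> b) \<and> (\<forall>a\<in>A. \<omega> (a\<^sup>\<star>) = (\<omega> a)\<^sup>\<star>)"

definition irreducible_star_representation ::
  "('l0::complex_hilbert \<Rightarrow>\<^sub>L 'l0) set
    \<Rightarrow> (('l0 \<Rightarrow>\<^sub>L 'l0) \<Rightarrow> ('l::complex_hilbert \<Rightarrow>\<^sub>L 'l)) \<Rightarrow> bool"
  where "irreducible_star_representation A \<omega> \<longleftrightarrow> star_representation A \<omega> \<and>
    (\<forall>p. projection p \<and> (\<forall>a\<in>A. p o\<^sub>L \<omega> a = \<omega> a o\<^sub>L p) \<longrightarrow> p = 0 \<or> p = id_blinfun)"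

definition weak_boundary_star_representation ::
  "('l0::complex_hilbert \<Rightarrow>\<^sub>L 'l0) set
    \<Rightarrow> (('l0 \<Rightarrow>\<^sub>L 'l0) \<Rightarrow> ('l::complex_hilbert \<Rightarrow>\<^sub>L 'l)) \<Rightarrow> bool"
  where "weak_boundary_star_representation S \<omega> \<longleftrightarrow>
    irreducible_star_representation (cstar_generated S) \<omega> \<and>
    (\<forall>V. isometry V \<and> (\<forall>s\<in>S. V\<^sup>\<star> o\<^sub>L \<omega> s o\<^sub>L V = \<omega> s) \<longrightarrow>
      (\<forall>a\<in>cstar_generated S. V\<^sup>\<star> o\<^sub>L \<omega> a o\<^sub>L V = \<omega> a))"


section \<open>The Paulsen system\<close>

definition paulsen_system ::
  "('h0::complex_hilbert \<Rightarrow>\<^sub>L 'k0::complex_hilbert) set \<Rightarrow> (('k0 \<times> 'h0) \<Rightarrow>\<^sub>L ('k0 \<times> 'h0)) set"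
  where "paulsen_system X =
    {block (\<alpha> *\<^sub>C id_blinfun) x (y\<^sup>\<star>) (\<beta> *\<^sub>C id_blinfun) | \<alpha> \<beta> x y. x \<in> X \<and> y \<in> X}"

text \<open>The closed linear spans \<open>TT\<^sup>\<star>\<close> and \<open>T\<^sup>\<star>T\<close>.\<close>

definition left_alg :: "('h0::complex_hilbert \<Rightarrow>\<^sub>L 'k0::complex_hilbert) set \<Rightarrow> ('k0 \<Rightarrow>\<^sub>L 'k0) set"
  where "left_alg T = closure (complex_vector.span {x o\<^sub>L y\<^sup>\<star> | x y. x \<in> T \<and> y \<in> T})"

definition right_alg :: "('h0::complex_hilbert \<Rightarrow>\<^sub>L 'k0::complex_hilbert) set \<Rightarrow> ('h0 \<Rightarrow>\<^sub>L 'h0) set"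
  where "right_alg T = closure (complex_vector.span {x\<^sup>\<star> o\<^sub>L y | x y. x \<in> T \<and> y \<in> T})"

text \<open>\<open>corresponding_representation X T \<theta> \<omega>\<close> says that \<open>\<omega>\<close> is the unital *-representation of the
  C*-algebra generated by the Paulsen system of \<open>X\<close> that corresponds to the representation \<open>\<theta>\<close> of
  \<open>T\<close>. Being multiplicative and *-preserving, \<open>\<omega>\<close> is determined by \<open>\<theta>\<close> on this algebra; its values
  elsewhere are irrelevant.\<close>

definition corresponding_representation ::
  "('h0::complex_hilbert \<Rightarrow>\<^sub>L 'k0::complex_hilbert) set \<Rightarrow> ('h0 \<Rightarrow>\<^sub>L 'k0) set
    \<Rightarrow> (('h0 \<Rightarrow>\<^sub>L 'k0) \<Rightarrow> ('h::complex_hilbert \<Rightarrow>\<^sub>L 'k::complex_hilbert))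
    \<Rightarrow> ((('k0 \<times> 'h0) \<Rightarrow>\<^sub>L ('k0 \<times> 'h0)) \<Rightarrow> (('k \<times> 'h) \<Rightarrow>\<^sub>L ('k \<times> 'h))) \<Rightarrow> bool"
  where "corresponding_representation X T \<theta> \<omega> \<longleftrightarrow>
    star_representation (cstar_generated (paulsen_system X)) \<omega> \<and>
    \<omega> id_blinfun = id_blinfun \<and>
    (\<exists>\<omega>\<^sub>1 \<omega>\<^sub>2.
      (\<forall>x\<in>T. \<forall>y\<in>T. \<omega>\<^sub>1 (x o\<^sub>L y\<^sup>\<star>) = \<theta> x o\<^sub>L (\<theta> y)\<^sup>\<star>) \<and>
      (\<forall>x\<in>T. \<forall>y\<in>T. \<omega>\<^sub>2 (x\<^sup>\<star> o\<^sub>L y) = (\<theta> x)\<^sup>\<star> o\<^sub>L \<theta> y) \<and>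
      (\<forall>a\<in>left_alg T. \<forall>b\<in>right_alg T. \<forall>x\<in>T. \<forall>y\<in>T. \<forall>\<alpha> \<beta>.
        \<omega> (block (a + \<alpha> *\<^sub>C id_blinfun) x (y\<^sup>\<star>) (b + \<beta> *\<^sub>C id_blinfun)) =
        block (\<omega>\<^sub>1 a + \<alpha> *\<^sub>C id_blinfun) (\<theta> x) ((\<theta> y)\<^sup>\<star>) (\<omega>\<^sub>2 b + \<beta> *\<^sub>C id_blinfun)))"

end

theory Submission
  imports Defs
begin

text \<open>
  An isometry \<open>V\<close> that compresses the diagonal of the Paulsen system to itself is diagonal,
  \<open>V = v \<oplus> u\<close>, and the corner then says \<open>v\<^sup>\<star> \<theta>(x) u = \<theta>(x)\<close> on \<open>X\<close>, hence on \<open>T\<close>. The point is that this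
  forces \<open>\<theta>(t) u = v \<theta>(t)\<close>, so that \<open>V\<close> commutes with \<open>\<omega>\<close>. Since \<open>v\<^sup>\<star>\<close> is contractive,
  \<open>\<parallel>r h\<parallel> \<le> \<parallel>r u h\<parallel>\<close> for every \<open>r \<in> \<theta>(T)\<close>; applied to odd polynomials in a column \<open>(a, b)\<close> with
  \<open>a, b \<in> \<theta>(T)\<close>, and combined with \<open>\<parallel>u h\<parallel> = \<parallel>h\<parallel>\<close>, this yields the reverse inequality
  \<open>\<parallel>a u h\<parallel> \<le> \<parallel>a h\<parallel>\<close> for \<open>h\<close> in the range of \<open>b\<^sup>\<star>\<close>, and equality means \<open>a u b\<^sup>\<star> = v a b\<^sup>\<star>\<close>. Irreducibility
  makes these ranges total unless \<open>\<theta> = 0\<close>.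
\<close>

section \<open>Adjoints\<close>

lemma comp_assoc: "(A o\<^sub>L B) o\<^sub>L C = A o\<^sub>L (B o\<^sub>L C)"
  by (rule blinfun_eqI) simp

lemma comp_id_left [simp]: "id_blinfun o\<^sub>L A = A"
  by (rule blinfun_eqI) simp

lemma comp_id_right [simp]: "A o\<^sub>L id_blinfun = A"
  by (rule blinfun_eqI) simp

lemmas comp_add_left = bounded_bilinear.add_left[OF bounded_bilinear_blinfun_compose]
lemmas comp_add_right = bounded_bilinear.add_right[OF bounded_bilinear_blinfun_compose]
lemmas comp_diff_left = bounded_bilinear.diff_left[OF bounded_bilinear_blinfun_compose]
lemmas comp_diff_right = bounded_bilinear.diff_right[OF bounded_bilinear_blinfun_compose]

lemma bops_scaleC: "A \<in> bops \<Longrightarrow> blinfun_apply A (c *\<^sub>C x) = c *\<^sub>C blinfun_apply A x"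
  by (simp add: bops_def)

lemma bopsI: "(\<And>c x. blinfun_apply A (c *\<^sub>C x) = c *\<^sub>C blinfun_apply A x) \<Longrightarrow> A \<in> bops"
  by (simp add: bops_def)

lemma inner_adj:
  assumes "A \<in> bops"
  shows "inner (blinfun_apply A x) y = inner x (blinfun_apply (A\<^sup>\<star>) y)"
  by (simp add: inner_eq_Re_cinner cinner_adj[OF assms])

lemma inner_eqI: "(\<And>x. inner x y = inner x z) \<Longrightarrow> y = (z :: 'a::real_inner)"
  by (metis inner_commute vector_eq_rdot)

lemma inner_scaleC_left:
  "inner (c *\<^sub>C x) y = inner x (cnj c *\<^sub>C (y :: 'a::complex_hilbert))"
  by (simp add: inner_eq_Re_cinner cinner_scaleC_left cinner_scaleC_right)

text \<open>The real inner product already separates vectors, so testing against it suffices;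
  \<open>A \<in> bops\<close> ensures that the description defining the adjoint has a
  solution.\<close>

lemma adj_eqI:
  assumes "A \<in> bops" "\<And>x y. inner (blinfun_apply A x) y = inner x (blinfun_apply B y)"
  shows "A\<^sup>\<star> = B"
proof (rule blinfun_eqI, rule inner_eqI)
  fix x y
  show "inner y (blinfun_apply (A\<^sup>\<star>) x) = inner y (blinfun_apply B x)"
    by (simp flip: inner_adj[OF assms(1)] assms(2))
qed

lemma adj_bops [simp]:
  assumes "A \<in> bops" shows "A\<^sup>\<star> \<in> bops"
proof (rule bopsI, rule inner_eqI)
  fix c x y
  have "inner y (c *\<^sub>C blinfun_apply (A\<^sup>\<star>) x) = inner (cnj c *\<^sub>C y) (blinfun_apply (A\<^sup>\<star>) x)"
    by (simp add: inner_scaleC_left)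
  also have "\<dots> = inner (cnj c *\<^sub>C blinfun_apply A y) x"
    by (simp add: bops_scaleC[OF assms] flip: inner_adj[OF assms])
  finally show "inner y (blinfun_apply (A\<^sup>\<star>) (c *\<^sub>C x)) = inner y (c *\<^sub>C blinfun_apply (A\<^sup>\<star>) x)"
    by (simp add: inner_scaleC_left flip: inner_adj[OF assms])
qed

lemma adj_adj [simp]: "A \<in> bops \<Longrightarrow> A\<^sup>\<star>\<^sup>\<star> = A"
  by (rule adj_eqI) (simp, metis inner_adj inner_commute)

lemma bops_compose [simp]: "A \<in> bops \<Longrightarrow> B \<in> bops \<Longrightarrow> A o\<^sub>L B \<in> bops"
  by (simp add: bops_def)

lemma bops_add [simp]: "A \<in> bops \<Longrightarrow> B \<in> bops \<Longrightarrow> A + B \<in> bops"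
  by (simp add: bops_def blinfun.add_left scaleC_add_right)

lemma bops_scale [simp]: "A \<in> bops \<Longrightarrow> c *\<^sub>C A \<in> bops"
  by (simp add: bops_def scaleC_scaleC mult.commute)

lemma bops_zero [simp]: "0 \<in> bops"
  by (simp add: bops_def)

lemma bops_id [simp]: "id_blinfun \<in> bops"
  by (simp add: bops_def)

lemma subspace_bops: "complex_vector.subspace bops"
  by (simp add: complex_vector.subspace_def)

lemma bops_diff [simp]: "A \<in> bops \<Longrightarrow> B \<in> bops \<Longrightarrow> A - B \<in> bops"
  using complex_vector.subspace_diff[OF subspace_bops] .

lemma adj_compose:
  "A \<in> bops \<Longrightarrow> B \<in> bops \<Longrightarrow> (A o\<^sub>L B)\<^sup>\<star> = B\<^sup>\<star> o\<^sub>L A\<^sup>\<star>"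
  by (rule adj_eqI) (auto simp: inner_adj)

lemma adj_add: "A \<in> bops \<Longrightarrow> B \<in> bops \<Longrightarrow> (A + B)\<^sup>\<star> = A\<^sup>\<star> + B\<^sup>\<star>"
  by (rule adj_eqI) (auto simp: inner_adj blinfun.add_left inner_add_left inner_add_right)

lemma adj_diff: "A \<in> bops \<Longrightarrow> B \<in> bops \<Longrightarrow> (A - B)\<^sup>\<star> = A\<^sup>\<star> - B\<^sup>\<star>"
  by (rule adj_eqI) (auto simp: inner_adj blinfun.diff_left inner_diff_left inner_diff_right)

lemma adj_scaleC: "A \<in> bops \<Longrightarrow> (c *\<^sub>C A)\<^sup>\<star> = cnj c *\<^sub>C A\<^sup>\<star>"
  by (rule adj_eqI) (auto simp: inner_adj inner_scaleC_left bops_scaleC)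

lemma adj_zero [simp]: "0\<^sup>\<star> = 0"
  by (rule adj_eqI) auto

lemma adj_id [simp]: "id_blinfun\<^sup>\<star> = id_blinfun"
  by (rule adj_eqI) auto

lemma norm_adj_le:
  assumes "A \<in> bops" shows "norm (A\<^sup>\<star>) \<le> norm A"
proof (rule norm_blinfun_bound)
  fix y
  have "(norm (blinfun_apply (A\<^sup>\<star>) y))\<^sup>2 = inner (blinfun_apply A (blinfun_apply (A\<^sup>\<star>) y)) y"
    by (simp add: power2_norm_eq_inner inner_adj[OF assms])
  also have "\<dots> \<le> norm A * norm (blinfun_apply (A\<^sup>\<star>) y) * norm y"
    by (meson mult_right_mono norm_blinfun norm_cauchy_schwarz norm_ge_zero order_trans)
  finally show "norm (blinfun_apply (A\<^sup>\<star>) y) \<le> norm A * norm y"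
    by (cases "blinfun_apply (A\<^sup>\<star>) y = 0") (auto simp: power2_eq_square mult.commute mult.left_commute)
qed simp

lemma norm_adj: "A \<in> bops \<Longrightarrow> norm (A\<^sup>\<star>) = norm A"
  by (metis adj_adj adj_bops norm_adj_le order_antisym)

lemma tendsto_adj:
  assumes "\<And>n. X n \<in> bops" "A \<in> bops" "X \<longlonglongrightarrow> A"
  shows "(\<lambda>n. (X n)\<^sup>\<star>) \<longlonglongrightarrow> A\<^sup>\<star>"
proof -
  have "(\<lambda>n. norm (X n - A)) \<longlonglongrightarrow> 0"
    using assms(3) by (simp add: LIM_zero tendsto_norm_zero)
  moreover have "norm (X n - A) = norm ((X n)\<^sup>\<star> - A\<^sup>\<star>)" for n
    using assms by (simp add: norm_adj flip: adj_diff)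
  ultimately show ?thesis
    by (simp add: LIM_zero_cancel tendsto_norm_zero_iff)
qed

lemma closed_bops: "closed (bops :: ('a::complex_hilbert \<Rightarrow>\<^sub>L 'b::complex_hilbert) set)"
proof -
  have "closed {A :: 'a \<Rightarrow>\<^sub>L 'b. blinfun_apply A (c *\<^sub>C x) = c *\<^sub>C blinfun_apply A x}" for c x
    by (intro closed_Collect_eq bounded_linear.continuous_on[OF bounded_linear_scaleC]
        continuous_intros)
  then show ?thesis
    unfolding bops_def by (intro closed_Collect_all)
qed

section \<open>Isometries and positivity of \<open>A\<^sup>\<star> o\<^sub>L A\<close>\<close>

lemma isometry_adj_comp:
  assumes "isometry V" shows "V\<^sup>\<star> o\<^sub>L V = id_blinfun"
proof (rule blinfun_eqI, rule inner_eqI)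
  fix x y
  have V: "V \<in> bops" "norm (blinfun_apply V z) = norm z" for z
    using assms by (auto simp: isometry_def)
  \<comment> \<open>Polarization: the norms of \<open>x + y\<close>, \<open>x\<close> and
    \<open>y\<close> determine the real inner product.\<close>
  have "inner (blinfun_apply V y) (blinfun_apply V x) = inner y x"
    using V(2)[of "x + y"] V(2)[of x] V(2)[of y]
    by (simp add: blinfun.add_right norm_eq_sqrt_inner inner_add_left inner_add_right inner_commute)
  then show "inner y (blinfun_apply (V\<^sup>\<star> o\<^sub>L V) x) = inner y (blinfun_apply id_blinfun x)"
    by (simp add: inner_adj[OF V(1)])
qed

lemma adj_comp_eq_0:
  assumes "A \<in> bops" "A\<^sup>\<star> o\<^sub>L A = 0"
  shows "A = 0"
proof (rule blinfun_eqI)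
  fix x
  have "inner (blinfun_apply A x) (blinfun_apply A x) = inner x (blinfun_apply (A\<^sup>\<star> o\<^sub>L A) x)"
    by (simp add: inner_adj[OF assms(1)])
  then show "blinfun_apply A x = blinfun_apply 0 x"
    by (simp add: assms(2))
qed

lemma isometryI:
  assumes "A \<in> bops" "A\<^sup>\<star> o\<^sub>L A = id_blinfun"
  shows "isometry A"
  unfolding isometry_def
proof (intro conjI allI assms(1))
  fix x
  have "inner (blinfun_apply A x) (blinfun_apply A x) = inner x (blinfun_apply (A\<^sup>\<star> o\<^sub>L A) x)"
    by (simp add: inner_adj[OF assms(1)])
  then show "norm (blinfun_apply A x) = norm x"
    by (simp add: assms(2) norm_eq_sqrt_inner)
qed

lemma norm_adj_isometry_le:
  assumes "isometry V" shows "norm (blinfun_apply (V\<^sup>\<star>) y) \<le> norm y"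
proof -
  have "norm V \<le> 1"
    using assms by (intro norm_blinfun_bound) (auto simp: isometry_def)
  then have "norm (V\<^sup>\<star>) \<le> 1"
    using assms by (simp add: norm_adj isometry_def)
  then show ?thesis
    by (intro order_trans[OF norm_blinfun] mult_left_le_one_le) auto
qed

section \<open>Generated TROs and C*-algebras\<close>

lemma tro_bops: "tro bops"
  by (simp add: tro_def subspace_bops closed_bops)

lemma cstar_algebra_bops: "cstar_algebra bops"
  by (simp add: cstar_algebra_def subspace_bops closed_bops)

text \<open>The defining conditions pass to intersections, and \<open>bops\<close> is a TRO
  containing \<open>X\<close>, which keeps the hull inside \<open>bops\<close>; the intersection of
  an empty family would be the whole type.\<close>

lemma tro_hull:
  assumes "X \<subseteq> bops" shows "tro (tro hull X)"
proof -
  have "tro hull X \<subseteq> bops"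
    using assms tro_bops by (rule hull_minimal)
  then show ?thesis
    unfolding tro_def
    by (auto simp: hull_def tro_def intro!: closed_Inter complex_vector.subspace_Inter)
qed

lemma cstar_algebra_generated:
  assumes "S \<subseteq> bops" shows "cstar_algebra (cstar_generated S)"
proof -
  have "cstar_algebra hull S \<subseteq> bops"
    using assms cstar_algebra_bops by (rule hull_minimal)
  then show ?thesis
    unfolding cstar_algebra_def cstar_generated_def
    by (auto simp: hull_def cstar_algebra_def intro!: closed_Inter complex_vector.subspace_Inter)
qed


section \<open>Block operators\<close>

lemma block_comp:
  "block a x z b o\<^sub>L block a' x' z' b' =
   block ((a o\<^sub>L a') + (x o\<^sub>L z')) ((a o\<^sub>L x') + (x o\<^sub>L b'))
     ((z o\<^sub>L a') + (b o\<^sub>L z')) ((z o\<^sub>L x') + (b o\<^sub>L b'))"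
  by (rule blinfun_eqI) (auto simp: block_apply blinfun.add_left blinfun.add_right split_paired_all)

lemma block_eq_iff:
  "block a x z b = block a' x' z' b' \<longleftrightarrow> a = a' \<and> x = x' \<and> z = z' \<and> b = b'"
proof
  assume eq: "block a x z b = block a' x' z' b'"
  have "blinfun_apply (block a x z b) (k, h) = blinfun_apply (block a' x' z' b') (k, h)" for k h
    by (simp add: eq)
  from this[of _ 0] this[of 0] show "a = a' \<and> x = x' \<and> z = z' \<and> b = b'"
    by (auto simp: block_apply intro!: blinfun_eqI)
qed simp

lemma block_cases:
  obtains a x z b where "W = block a x z b"
proof
  \<comment> \<open>The coordinate embeddings: the entries of \<open>W\<close> arise by composing
    with them and with the coordinate projections.\<close>
  define i1 where "i1 = Blinfun (\<lambda>k::'a. (k, 0 :: 'b))"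
  define i2 where "i2 = Blinfun (\<lambda>h::'b. (0 :: 'a, h))"
  have 1: "blinfun_apply i1 k = (k, 0)" for k
    by (simp add: i1_def bounded_linear_Blinfun_apply bounded_linear_Pair)
  have 2: "blinfun_apply i2 h = (0, h)" for h
    unfolding i2_def
    by (subst bounded_linear_Blinfun_apply) (auto intro!: bounded_linear_Pair)
  show "W = block (fst_blinfun o\<^sub>L W o\<^sub>L i1) (fst_blinfun o\<^sub>L W o\<^sub>L i2)
    (snd_blinfun o\<^sub>L W o\<^sub>L i1) (snd_blinfun o\<^sub>L W o\<^sub>L i2)"
  proof (rule blinfun_eqI)
    fix p
    have "blinfun_apply W p = blinfun_apply W (fst p, 0) + blinfun_apply W (0, snd p)"
      by (simp flip: blinfun.add_right)
    then show "blinfun_apply W p = blinfun_apply (block (fst_blinfun o\<^sub>L W o\<^sub>L i1)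
      (fst_blinfun o\<^sub>L W o\<^sub>L i2) (snd_blinfun o\<^sub>L W o\<^sub>L i1) (snd_blinfun o\<^sub>L W o\<^sub>L i2)) p"
      by (simp add: block.rep_eq 1 2 fst_blinfun.rep_eq snd_blinfun.rep_eq prod_eq_iff)
  qed
qed

lemma block_zero: "block 0 0 0 0 = 0"
  by (rule blinfun_eqI) (auto simp: block_apply zero_prod_def)

lemma block_id: "block id_blinfun 0 0 id_blinfun = id_blinfun"
  by (rule blinfun_eqI) (auto simp: block_apply)

lemma block_add:
  "block a x z b + block a' x' z' b' = block (a + a') (x + x') (z + z') (b + b')"
  by (rule blinfun_eqI) (auto simp: block_apply blinfun.add_left)

lemma block_scaleC: "c *\<^sub>C block a x z b = block (c *\<^sub>C a) (c *\<^sub>C x) (c *\<^sub>C z) (c *\<^sub>C b)"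
  by (rule blinfun_eqI) (auto simp: block_apply scaleC_prod_def scaleC_add_right)

lemma block_bops_iff:
  "block a x z b \<in> bops \<longleftrightarrow> a \<in> bops \<and> x \<in> bops \<and> z \<in> bops \<and> b \<in> bops"
proof
  assume *: "block a x z b \<in> bops"
  have "blinfun_apply (block a x z b) (c *\<^sub>C k, c *\<^sub>C h) = c *\<^sub>C blinfun_apply (block a x z b) (k, h)" for c k h
    using bops_scaleC[OF *, of c "(k, h)"] by (simp add: scaleC_prod_def)
  from this[of _ _ 0] this[of _ 0] show "a \<in> bops \<and> x \<in> bops \<and> z \<in> bops \<and> b \<in> bops"
    by (auto simp: block_apply scaleC_prod_def intro!: bopsI)
qed (auto simp: bops_def block_apply scaleC_prod_def scaleC_add_right)

lemma adj_block:
  assumes "a \<in> bops" "x \<in> bops" "z \<in> bops" "b \<in> bops"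
  shows "(block a x z b)\<^sup>\<star> = block (a\<^sup>\<star>) (z\<^sup>\<star>) (x\<^sup>\<star>) (b\<^sup>\<star>)"
  using assms
  by (intro adj_eqI)
    (auto simp: block_bops_iff block_apply inner_prod_def inner_add_left inner_add_right inner_adj)

text \<open>Continuity of the corner embedding turns closedness of a C*-algebra into closedness of
  the set of operators whose corner lies in it.\<close>

lemma bounded_linear_block_corner: "bounded_linear (\<lambda>x. block 0 x 0 0)"
proof (rule bounded_linear_intro)
  fix r :: real and x y :: "'a \<Rightarrow>\<^sub>L 'b"
  show "block 0 (x + y) 0 0 = block 0 x 0 0 + block 0 y 0 0"
    by (simp add: block_add)
  show "block 0 (r *\<^sub>R x) 0 0 = r *\<^sub>R block 0 x 0 0"
    by (simp add: scaleR_scaleC block_scaleC)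
  show "norm (block 0 x 0 0) \<le> norm x * 1"
  proof (rule norm_blinfun_bound)
    fix p :: "'b \<times> 'a"
    have "norm (blinfun_apply (block 0 x 0 0) p) = norm (blinfun_apply x (snd p))"
      by (cases p) (simp add: block_apply norm_Pair)
    also have "\<dots> \<le> norm x * norm (snd p)"
      by (rule norm_blinfun)
    also have "\<dots> \<le> norm x * norm p"
      by (cases p) (simp add: mult_left_mono norm_snd_le)
    finally show "norm (blinfun_apply (block 0 x 0 0) p) \<le> norm x * 1 * norm p"
      by simp
  qed simp
qed


section \<open>Orthogonal projections\<close>

text \<open>Near-minimizers of the distance to \<open>x\<close> form nested closed sets whose
  diameters shrink by the parallelogram law. Their common point is nearest to \<open>x\<close>, and
  the first variation of the distance gives orthogonality.\<close>

lemma orthogonal_decomposition: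
  fixes N :: "'a::{real_inner, complete_space} set"
  assumes N: "closed N" "subspace N"
  shows "\<exists>m\<in>N. \<forall>y\<in>N. inner (x - m) y = 0"
proof -
  define d where "d = Inf ((\<lambda>y. (norm (x - y))\<^sup>2) ` N)"
  define S where "S n = {y \<in> N. (norm (x - y))\<^sup>2 \<le> d + 1 / real (Suc n)}" for n
  have bdd: "bdd_below ((\<lambda>y. (norm (x - y))\<^sup>2) ` N)"
    by (rule bdd_belowI2[where m = 0]) simp
  have d: "d \<le> (norm (x - y))\<^sup>2" if "y \<in> N" for y
    unfolding d_def by (rule cInf_lower[OF _ bdd]) (use that in auto)
  have nonempty: "N \<noteq> {}"
    using subspace_0[OF N(2)] by auto
  obtain m where m: "\<And>n. m \<in> S n"
  proof (rule decreasing_closed_nest[of S])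
    fix n
    have "S n = N \<inter> {y. (norm (x - y))\<^sup>2 \<le> d + 1 / real (Suc n)}"
      by (auto simp: S_def)
    moreover have "closed {y. (norm (x - y))\<^sup>2 \<le> d + 1 / real (Suc n)}"
      by (intro closed_Collect_le continuous_intros)
    ultimately show "closed (S n)"
      using N(1) by auto
    have "\<exists>z\<in>(\<lambda>y. (norm (x - y))\<^sup>2) ` N. z < d + 1 / real (Suc n)"
      using nonempty unfolding d_def by (subst cInf_less_iff[OF _ bdd, symmetric]) auto
    then show "S n \<noteq> {}"
      unfolding S_def by (auto intro: less_imp_le)
  next
    fix k n :: nat
    assume "k \<le> n"
    then have "1 / real (Suc n) \<le> 1 / real (Suc k)"
      by (simp add: frac_le)
    then show "S n \<subseteq> S k"
      by (auto simp: S_def)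
  next
    fix e :: real
    assume "e > 0"
    obtain n where n: "4 / e\<^sup>2 < real n"
      using reals_Archimedean2 by blast
    have "dist y z < e" if "y \<in> S n" "z \<in> S n" for y z
    proof -
      \<comment> \<open>The midpoint lies in \<open>N\<close>, so its squared distance to
        \<open>x\<close> is at least \<open>d\<close>; the parallelogram law subtracts four times
        this quantity.\<close>
      have mid: "(1/2) *\<^sub>R (y + z) \<in> N"
        using that N(2) by (auto simp: S_def subspace_add subspace_scale)
      have "(norm (y - z))\<^sup>2 = 2 * (norm (x - y))\<^sup>2 + 2 * (norm (x - z))\<^sup>2
          - 4 * (norm (x - (1/2) *\<^sub>R (y + z)))\<^sup>2"
        by (simp add: power2_norm_eq_inner algebra_simps inner_commute)
      also have "\<dots> \<le> 2 * (d + 1 / real (Suc n)) + 2 * (d + 1 / real (Suc n)) - 4 * d"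
        using that d[OF mid] unfolding S_def by (intro diff_mono add_mono mult_left_mono) auto
      also have "\<dots> = 4 / real (Suc n)"
        by simp
      also have "\<dots> < e\<^sup>2"
      proof -
        have "4 / e\<^sup>2 < real (Suc n)"
          using n by simp
        then show ?thesis
          using \<open>e > 0\<close> by (simp add: field_simps)
      qed
      finally show ?thesis
        using \<open>e > 0\<close> by (simp add: dist_norm power2_less_imp_less)
    qed
    then show "\<exists>n. \<forall>y\<in>S n. \<forall>z\<in>S n. dist y z < e"
      by blast
  qed (rule that)
  have mN: "m \<in> N"
    using m[of 0] by (simp add: S_def)
  have md: "(norm (x - m))\<^sup>2 \<le> d"
  proof (rule field_le_epsilon)
    fix e :: real
    assume "e > 0"
    then obtain n where "inverse (real (Suc n)) < e"
      using reals_Archimedean by blast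
    then show "(norm (x - m))\<^sup>2 \<le> d + e"
      using m[of n] by (simp add: S_def inverse_eq_divide)
  qed
  have "inner (x - m) y = 0" if "y \<in> N" for y
  proof (rule ccontr)
    assume nz: "inner (x - m) y \<noteq> 0"
    define c where "c = inner (x - m) y"
    define q where "q = inner y y"
    have q: "q > 0"
      using nz by (auto simp: q_def)
    \<comment> \<open>The scalar \<open>c / q\<close> minimizes the distance from
      \<open>x - m\<close> to the line spanned by \<open>y\<close>; the gain
      \<open>c\<^sup>2 / q\<close> would undercut the infimum.\<close>
    have "m + (c / q) *\<^sub>R y \<in> N"
      using mN that N(2) by (simp add: subspace_add subspace_scale)
    from d[OF this] have "d \<le> (norm ((x - m) - (c / q) *\<^sub>R y))\<^sup>2"
      by (simp add: algebra_simps)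
    also have "\<dots> = (norm (x - m))\<^sup>2 - 2 * (c / q) * c + (c / q)\<^sup>2 * q"
      unfolding power2_norm_eq_inner inner_diff_left[of "x - m"] inner_diff_right[of _ "x - m"]
      by (simp add: c_def q_def inner_commute power2_eq_square)
    also have "\<dots> = (norm (x - m))\<^sup>2 - c\<^sup>2 / q"
      using q by (simp add: power2_eq_square field_simps)
    also have "\<dots> < d"
      using md q nz by (smt (verit) c_def divide_pos_pos zero_less_power2)
    finally show False by simp
  qed
  with mN show ?thesis by blast
qed

text \<open>Orthogonality is expressed by the real inner product; the projection is nevertheless
  complex linear because \<open>N\<close> is invariant under complex scalars.\<close>

lemma projection_onto:
  fixes N :: "'a::complex_hilbert set"
  assumes N: "closed N" "complex_vector.subspace N"
  obtains p where "projection p" "\<And>x. blinfun_apply p x \<in> N" "\<And>x. x \<in> N \<Longrightarrow> blinfun_apply p x = x"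
proof -
  have sub: "subspace N"
    using N(2) by (auto simp: subspace_def complex_vector.subspace_def scaleR_scaleC)
  define P where "P x = (SOME m. m \<in> N \<and> (\<forall>y\<in>N. inner (x - m) y = 0))" for x
  have "P x \<in> N \<and> (\<forall>y\<in>N. inner (x - P x) y = 0)" for x
    unfolding P_def
    by (rule someI_ex) (use orthogonal_decomposition[OF N(1) sub, of x] in blast)
  then have PN: "\<And>x. P x \<in> N" and orth: "\<And>x y. y \<in> N \<Longrightarrow> inner (x - P x) y = 0"
    by blast+
  \<comment> \<open>The values of \<open>P\<close> come from a choice; uniqueness of the orthogonal
    decomposition is what makes \<open>P\<close> linear.\<close>
  have unique: "P x = m" if "m \<in> N" "\<And>y. y \<in> N \<Longrightarrow> inner (x - m) y = 0" for x m
  proof -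
    have D: "P x - m \<in> N"
      using PN that(1) sub by (simp add: subspace_diff)
    have "inner (P x - m) (P x - m) = inner (x - m) (P x - m) - inner (x - P x) (P x - m)"
      by (simp add: inner_diff_left)
    also have "\<dots> = 0"
      using that(2)[OF D] orth[OF D] by simp
    finally show ?thesis by simp
  qed
  have scale: "P (c *\<^sub>C x) = c *\<^sub>C P x" for c x
  proof (rule unique)
    show "c *\<^sub>C P x \<in> N"
      using PN N(2) by (simp add: complex_vector.subspace_scale)
    fix y assume "y \<in> N"
    then have "cnj c *\<^sub>C y \<in> N"
      using N(2) by (simp add: complex_vector.subspace_scale)
    then show "inner (c *\<^sub>C x - c *\<^sub>C P x) y = 0"
      by (simp add: orth inner_scaleC_left flip: complex_vector.scale_right_diff_distrib)
  qed
  have "bounded_linear P"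
  proof (rule bounded_linear_intro)
    show "P (x + y) = P x + P y" for x y
    proof (rule unique)
      show "P x + P y \<in> N"
        using PN sub by (simp add: subspace_add)
      fix z assume "z \<in> N"
      then show "inner (x + y - (P x + P y)) z = 0"
        using orth[of z x] orth[of z y] by (simp add: inner_diff_left inner_add_left)
    qed
    show "P (r *\<^sub>R x) = r *\<^sub>R P x" for r x
      by (simp add: scaleR_scaleC scale)
    show "norm (P x) \<le> norm x * 1" for x
    proof -
      have "(norm (P x))\<^sup>2 = inner x (P x)"
        using orth[OF PN, of x x] by (simp add: inner_diff_left power2_norm_eq_inner)
      also have "\<dots> \<le> norm x * norm (P x)"
        by (rule norm_cauchy_schwarz)
      finally show ?thesis
        by (cases "P x = 0") (auto simp: power2_eq_square)
    qed
  qed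
  then have app: "blinfun_apply (Blinfun P) = P"
    by (rule bounded_linear_Blinfun_apply)
  have P_id: "P x = x" if "x \<in> N" for x
    by (rule unique) (use that in auto)
  have bops: "Blinfun P \<in> bops"
    by (simp add: bops_def app scale)
  have "projection (Blinfun P)"
    unfolding projection_def
  proof (intro conjI bops)
    show "Blinfun P o\<^sub>L Blinfun P = Blinfun P"
      by (rule blinfun_eqI) (simp add: app P_id PN)
    show "(Blinfun P)\<^sup>\<star> = Blinfun P"
    proof (rule adj_eqI[OF bops])
      fix x y
      have "inner (P x) y = inner (P x) (P y)"
        using orth[OF PN[of x], of y] by (simp add: inner_diff_left inner_diff_right inner_commute)
      also have "\<dots> = inner x (P y)"
        using orth[OF PN[of y], of x] by (simp add: inner_diff_left inner_diff_right inner_commute)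
      finally show "inner (blinfun_apply (Blinfun P) x) y = inner x (blinfun_apply (Blinfun P) y)"
        by (simp add: app)
    qed
  qed
  then show ?thesis
    using that[of "Blinfun P"] by (simp add: app PN P_id)
qed


section \<open>Intertwining on ternary spaces\<close>

text \<open>With \<open>D = a\<^sup>\<star>a + b\<^sup>\<star>b \<le> 1\<close> and \<open>C = 1 - D\<close>, the identity
  \<open>\<Sum>m<M. D (1 + C)\<^sup>2 C\<^bsup>2m\<^esup> = (1 + C) (1 - C\<^bsup>2M\<^esup>)\<close> turns the inequalities for \<open>r (1 + C) C\<^sup>m\<close>, \<open>r \<in> {a, b}\<close>,
  into one for the quadratic form \<open>\<Phi>\<close> of \<open>1 + C = 2 - D\<close>, in which \<open>D\<close> has the opposite sign. The
  remainder vanishes because \<open>C\<^sup>m b\<^sup>\<star> \<longlongrightarrow> 0\<close> strongly.\<close>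

lemma ternary_isometry_norm_eq:
  fixes R :: "('h::complex_hilbert \<Rightarrow>\<^sub>L 'k::complex_hilbert) set"
  assumes bops: "R \<subseteq> bops" and sub: "complex_vector.subspace R"
    and ternary: "\<And>x y z. x \<in> R \<Longrightarrow> y \<in> R \<Longrightarrow> z \<in> R \<Longrightarrow> x o\<^sub>L y\<^sup>\<star> o\<^sub>L z \<in> R"
    and le: "\<And>r h. r \<in> R \<Longrightarrow> norm (blinfun_apply r h) \<le> norm (blinfun_apply r (u h))"
    and u: "\<And>h. norm (u h) = norm h"
    and ab: "a \<in> R" "b \<in> R" and small: "(norm a)\<^sup>2 + (norm b)\<^sup>2 \<le> 1"
  shows "norm (blinfun_apply a (u (blinfun_apply (b\<^sup>\<star>) k))) = norm (blinfun_apply a (blinfun_apply (b\<^sup>\<star>) k))"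
proof -
  have a: "a \<in> bops" and b: "b \<in> bops"
    using ab bops by auto
  define D where "D = blinfun_apply ((a\<^sup>\<star> o\<^sub>L a) + (b\<^sup>\<star> o\<^sub>L b))"
  \<comment> \<open>\<open>C\<close> is a plain function, so that its powers are iterates.
    \<open>Q\<close> is the quadratic form of \<open>D\<close>.\<close>
  define C where "C x = x - D x" for x
  define Q where "Q x = (norm (blinfun_apply a x))\<^sup>2 + (norm (blinfun_apply b x))\<^sup>2" for x
  define \<Phi> where "\<Phi> y = inner y y + inner (C y) y" for y
  have D_apply: "D x = blinfun_apply (a\<^sup>\<star>) (blinfun_apply a x) + blinfun_apply (b\<^sup>\<star>) (blinfun_apply b x)" for x
    by (simp add: D_def blinfun.add_left)
  have D_diff: "D (x - y) = D x - D y" and D_add: "D (x + y) = D x + D y" for x y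
    by (simp_all add: D_def blinfun.diff_right blinfun.add_right)
  have D_inner: "inner x (D y) = inner (blinfun_apply a x) (blinfun_apply a y) + inner (blinfun_apply b x) (blinfun_apply b y)" for x y
    by (simp add: D_apply inner_add_right inner_adj[OF a] inner_adj[OF b])
  have D_sym: "inner (D x) y = inner x (D y)" for x y
    using D_inner[of x y] D_inner[of y x] by (simp add: inner_commute)
  have Q_inner: "Q x = inner (D x) x" for x
    by (simp add: D_sym D_inner Q_def power2_norm_eq_inner)
  have Q_nonneg: "Q x \<ge> 0" for x
    by (simp add: Q_def)
  \<comment> \<open>In operator terms \<open>D^2 \<le> D\<close>: the column with entries
    \<open>a\<close> and \<open>b\<close> is a contraction. The bound is Cauchy-Schwarz in two
    coordinates, applied to the norms.\<close>
  have norm_D: "(norm (D x))\<^sup>2 \<le> Q x" for x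
  proof -
    define p q where "p = norm (blinfun_apply a x)" and "q = norm (blinfun_apply b x)"
    have "norm (D x) \<le> norm (blinfun_apply (a\<^sup>\<star>) (blinfun_apply a x)) + norm (blinfun_apply (b\<^sup>\<star>) (blinfun_apply b x))"
      unfolding D_apply by (rule norm_triangle_ineq)
    also have "\<dots> \<le> norm a * p + norm b * q"
      unfolding p_def q_def using norm_blinfun[of "a\<^sup>\<star>"] norm_blinfun[of "b\<^sup>\<star>"]
      by (intro add_mono) (simp_all add: norm_adj a b)
    finally have "(norm (D x))\<^sup>2 \<le> (norm a * p + norm b * q)\<^sup>2"
      by (simp add: power_mono)
    also have "\<dots> \<le> ((norm a)\<^sup>2 + (norm b)\<^sup>2) * (p\<^sup>2 + q\<^sup>2)"
      using zero_le_power2[of "norm a * q - norm b * p"] by (simp add: power2_eq_square algebra_simps)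
    also have "\<dots> \<le> 1 * (p\<^sup>2 + q\<^sup>2)"
      by (intro mult_right_mono small) simp
    finally show ?thesis
      by (simp add: Q_def p_def q_def)
  qed
  have C_sym: "inner (C x) y = inner x (C y)" for x y
    by (simp add: C_def inner_diff_left inner_diff_right D_sym)
  have Cm_sym: "inner ((C ^^ m) x) y = inner x ((C ^^ m) y)" for m x y
    by (induction m arbitrary: y) (simp_all add: C_sym flip: funpow_swap1)
  \<comment> \<open>From \<open>C^2 = 1 - 2 D + D^2\<close> and \<open>D^2 \<le> D\<close> follows
    \<open>C^2 \<le> 1 - D\<close>.\<close>
  have norm_C: "(norm (C x))\<^sup>2 \<le> (norm x)\<^sup>2 - Q x" for x
  proof -
    have "(norm (C x))\<^sup>2 = (norm x)\<^sup>2 - 2 * Q x + (norm (D x))\<^sup>2"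
      by (simp add: C_def power2_norm_eq_inner inner_diff_left inner_diff_right Q_inner inner_commute)
    then show ?thesis
      using norm_D[of x] by linarith
  qed
  have inner_C: "\<bar>inner (C x) x\<bar> \<le> (norm x)\<^sup>2" for x
  proof -
    have "(norm (C x))\<^sup>2 \<le> (norm x)\<^sup>2"
      using norm_C[of x] Q_nonneg[of x] by linarith
    then have "norm (C x) \<le> norm x"
      by (rule power2_le_imp_le) simp
    then have "norm (C x) * norm x \<le> norm x * norm x"
      by (rule mult_right_mono) simp
    then show ?thesis
      using Cauchy_Schwarz_ineq2[of "C x" x] by (simp add: power2_eq_square)
  qed
  \<comment> \<open>\<open>1 + C\<close> lies between 0 and 2 because \<open>C\<close> is a
    contraction.\<close>
  have \<Phi>_nonneg: "\<Phi> x \<ge> 0" and \<Phi>_le: "\<Phi> x \<le> 2 * (norm x)\<^sup>2" for x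
    using inner_C[of x] by (auto simp: \<Phi>_def power2_norm_eq_inner)
  \<comment> \<open>Since \<open>1 - C^2 = D (1 + C)\<close>, both sides are the quadratic form of
    \<open>D (1 + C)^2\<close>.\<close>
  have key: "Q (y + C y) = \<Phi> y - \<Phi> (C y)" for y
    by (simp add: Q_inner \<Phi>_def C_def D_diff D_add inner_diff_left inner_diff_right inner_add_left
        inner_add_right D_sym inner_commute)
  \<comment> \<open>Multiplying out \<open>r C\<close> gives \<open>r\<close> minus two ternary
    products, so it remains in \<open>R\<close>.\<close>
  have mult_C: "\<exists>r'\<in>R. \<forall>x. blinfun_apply r' x = blinfun_apply r (C x)" if r: "r \<in> R" for r
  proof
    show "r - ((r o\<^sub>L a\<^sup>\<star> o\<^sub>L a) + (r o\<^sub>L b\<^sup>\<star> o\<^sub>L b)) \<in> R"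
      using r ab sub ternary by (simp add: complex_vector.subspace_diff complex_vector.subspace_add)
    show "\<forall>x. blinfun_apply (r - ((r o\<^sub>L a\<^sup>\<star> o\<^sub>L a) + (r o\<^sub>L b\<^sup>\<star> o\<^sub>L b))) x = blinfun_apply r (C x)"
      by (simp add: C_def D_apply blinfun.diff_left blinfun.add_left blinfun.diff_right blinfun.add_right)
  qed
  have mult_Cm: "\<exists>r'\<in>R. \<forall>x. blinfun_apply r' x = blinfun_apply r ((C ^^ m) x)" if "r \<in> R" for r m
    using that
  proof (induction m arbitrary: r)
    case (Suc m)
    then obtain r1 where "r1 \<in> R" "\<forall>x. blinfun_apply r1 x = blinfun_apply r (C x)"
      using mult_C by blast
    with Suc.IH[of r1] show ?case by auto
  qed auto
  \<comment> \<open>This is the hypothesis \<open>le\<close> for the element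
    \<open>r (1 + C) C^m\<close> of \<open>R\<close>.\<close>
  have mult_F: "norm (blinfun_apply r ((C ^^ m) h + (C ^^ Suc m) h))
      \<le> norm (blinfun_apply r ((C ^^ m) (u h) + (C ^^ Suc m) (u h)))" if r: "r \<in> R" for r m h
  proof -
    obtain r1 r2 where r12: "r1 \<in> R" "r2 \<in> R" "\<And>x. blinfun_apply r1 x = blinfun_apply r ((C ^^ m) x)"
        "\<And>x. blinfun_apply r2 x = blinfun_apply r ((C ^^ Suc m) x)"
      using mult_Cm[OF r, of m] mult_Cm[OF r, of "Suc m"] by blast
    then have "r1 + r2 \<in> R"
      using sub by (simp add: complex_vector.subspace_add)
    from le[OF this, of h] show ?thesis
      by (simp only: blinfun.add_left blinfun.add_right r12)
  qed
  have QF: "Q ((C ^^ m) h + (C ^^ Suc m) h) \<le> Q ((C ^^ m) (u h) + (C ^^ Suc m) (u h))" for m h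
    unfolding Q_def using mult_F ab by (intro add_mono power_mono) auto
  have telescope: "(\<Sum>m<M. Q ((C ^^ m) x + (C ^^ Suc m) x)) = \<Phi> x - \<Phi> ((C ^^ M) x)" for M x
    by (induction M) (simp_all add: key)
  define y where "y = blinfun_apply (b\<^sup>\<star>) k"
  \<comment> \<open>By \<open>norm_C\<close> each term is at most a difference of successive squared
    norms. The partial sums are thus bounded, which forces the terms to tend to 0.\<close>
  have "(\<Sum>m<M. Q ((C ^^ m) y)) \<le> (norm y)\<^sup>2 - (norm ((C ^^ M) y))\<^sup>2" for M
  proof (induction M)
    case (Suc M)
    then show ?case
      using norm_C[of "(C ^^ M) y"] by simp
  qed simp
  then have "(\<Sum>m<M. Q ((C ^^ m) y)) \<le> (norm y)\<^sup>2" for M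
    by (smt (verit) zero_le_power2)
  then have "(\<lambda>m. Q ((C ^^ m) y)) \<longlonglongrightarrow> 0"
    by (intro summable_LIMSEQ_zero summableI_nonneg_bounded Q_nonneg)
  then have "(\<lambda>m. Q ((C ^^ (2 * m)) y)) \<longlonglongrightarrow> 0"
    by (rule LIMSEQ_subseq_LIMSEQ[unfolded o_def]) (simp add: strict_mono_def)
  then have lim: "(\<lambda>m. 2 * (sqrt (Q ((C ^^ (2 * m)) y)) * norm k)) \<longlonglongrightarrow> 2 * (sqrt 0 * norm k)"
    by (intro tendsto_intros)
  \<comment> \<open>Here it matters that \<open>y\<close> lies in the range of the adjoint of
    \<open>b\<close>. The squared norm of \<open>C^m y\<close> is the inner product of
    \<open>C^(2m) y\<close> with \<open>y\<close>; moving \<open>b\<close> across turns it into one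
    with \<open>k\<close>, which \<open>Q\<close> controls. This accounts for the doubled
    exponent.\<close>
  have \<Phi>_C: "\<Phi> ((C ^^ m) y) \<le> 2 * (sqrt (Q ((C ^^ (2 * m)) y)) * norm k)" for m
  proof -
    have "(norm ((C ^^ m) y))\<^sup>2 = inner ((C ^^ (2 * m)) y) y"
      by (simp add: power2_norm_eq_inner Cm_sym[of m y] mult_2 funpow_add inner_commute)
    also have "\<dots> = inner (blinfun_apply b ((C ^^ (2 * m)) y)) k"
      by (simp add: inner_adj[OF b] flip: y_def)
    also have "\<dots> \<le> norm (blinfun_apply b ((C ^^ (2 * m)) y)) * norm k"
      by (rule norm_cauchy_schwarz)
    also have "\<dots> \<le> sqrt (Q ((C ^^ (2 * m)) y)) * norm k"
      by (intro mult_right_mono real_le_rsqrt) (simp_all add: Q_def)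
    finally show ?thesis
      using \<Phi>_le[of "(C ^^ m) y"] by linarith
  qed
  have "\<Phi> y - 2 * (sqrt (Q ((C ^^ (2 * m)) y)) * norm k) \<le> \<Phi> (u y)" for m
  proof -
    have "\<Phi> y - \<Phi> ((C ^^ m) y) \<le> \<Phi> (u y) - \<Phi> ((C ^^ m) (u y))"
      unfolding telescope[symmetric] by (rule sum_mono) (rule QF)
    then show ?thesis
      using \<Phi>_C[of m] \<Phi>_nonneg[of "(C ^^ m) (u y)"] by linarith
  qed
  then have "\<Phi> y - 2 * (sqrt 0 * norm k) \<le> \<Phi> (u y)"
    by (intro LIMSEQ_le_const2[OF tendsto_diff[OF tendsto_const lim]]) auto
  \<comment> \<open>As \<open>u\<close> preserves norms, a lower bound for
    \<open>\<Phi> (u y)\<close> is an upper bound for \<open>Q (u y)\<close>: the inequality changes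
    direction.\<close>
  moreover have "\<Phi> x = 2 * (norm x)\<^sup>2 - Q x" for x
    by (simp add: \<Phi>_def C_def inner_diff_left Q_inner power2_norm_eq_inner)
  ultimately have "Q (u y) \<le> Q y"
    by (simp add: u)
  \<comment> \<open>Subtracting the opposite inequality for \<open>b\<close> leaves the desired one
    for \<open>a\<close>.\<close>
  moreover have "(norm (blinfun_apply b y))\<^sup>2 \<le> (norm (blinfun_apply b (u y)))\<^sup>2"
    using le[OF ab(2)] by (simp add: power_mono)
  ultimately have "(norm (blinfun_apply a (u y)))\<^sup>2 \<le> (norm (blinfun_apply a y))\<^sup>2"
    unfolding Q_def by linarith
  then have "norm (blinfun_apply a (u y)) \<le> norm (blinfun_apply a y)"
    by (rule power2_le_imp_le) simp
  then show ?thesis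
    using le[OF ab(1), of y] by (simp add: y_def)
qed

text \<open>Contractivity of the adjoint of \<open>v\<close> yields the norm inequality for every
  \<open>r \<in> R\<close>, hence a norm equality on the range of the adjoint of \<open>b\<close>. A
  vector that loses no norm under the adjoint of an isometry lies in the range of that isometry, so
  \<open>a u y\<close> must be \<open>v a y\<close>.\<close>

lemma compression_fixed_intertwines:
  fixes R :: "('h::complex_hilbert \<Rightarrow>\<^sub>L 'k::complex_hilbert) set"
  assumes R: "R \<subseteq> bops" "complex_vector.subspace R"
      "\<And>x y z. x \<in> R \<Longrightarrow> y \<in> R \<Longrightarrow> z \<in> R \<Longrightarrow> x o\<^sub>L y\<^sup>\<star> o\<^sub>L z \<in> R"
    and u: "isometry u" and v: "isometry v"
    and fixed: "\<And>r. r \<in> R \<Longrightarrow> v\<^sup>\<star> o\<^sub>L r o\<^sub>L u = r"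
    and ab: "a \<in> R" "b \<in> R"
  shows "a o\<^sub>L u o\<^sub>L b\<^sup>\<star> = v o\<^sub>L a o\<^sub>L b\<^sup>\<star>"
proof (rule blinfun_eqI)
  fix k
  \<comment> \<open>Rescaling makes the column contractive; the summand 1 keeps the denominator
    positive when \<open>a\<close> and \<open>b\<close> vanish, and \<open>c\<close> cancels
    afterwards.\<close>
  define c where "c = 1 / (1 + norm a + norm b)"
  have c: "c > 0"
    by (simp add: c_def add_pos_nonneg)
  have bops: "a \<in> bops" "b \<in> bops"
    using ab R(1) by auto
  have fixed_apply: "blinfun_apply (v\<^sup>\<star>) (blinfun_apply r (blinfun_apply u h)) = blinfun_apply r h" if "r \<in> R" for r h
    using fixed[OF that] by (metis blinfun_apply_blinfun_compose)
  have scaled: "c *\<^sub>R a \<in> R" "c *\<^sub>R b \<in> R"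
    using ab R(2) by (simp_all add: scaleR_scaleC complex_vector.subspace_scale)
  have adj_b: "(c *\<^sub>R b)\<^sup>\<star> = c *\<^sub>R b\<^sup>\<star>"
    using bops(2) by (simp add: scaleR_scaleC adj_scaleC)
  have "(norm a)\<^sup>2 + (norm b)\<^sup>2 \<le> (1 + norm a + norm b)\<^sup>2"
    by (simp add: power2_eq_square algebra_simps)
  then have small: "(norm (c *\<^sub>R a))\<^sup>2 + (norm (c *\<^sub>R b))\<^sup>2 \<le> 1"
    by (simp add: c_def power_divide divide_simps add_pos_nonneg)
  have "norm (blinfun_apply (c *\<^sub>R a) (blinfun_apply u (blinfun_apply ((c *\<^sub>R b)\<^sup>\<star>) k)))
      = norm (blinfun_apply (c *\<^sub>R a) (blinfun_apply ((c *\<^sub>R b)\<^sup>\<star>) k))"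
  proof (rule ternary_isometry_norm_eq[OF R _ _ scaled small])
    fix r h
    assume "r \<in> R"
    show "norm (blinfun_apply r h) \<le> norm (blinfun_apply r (blinfun_apply u h))"
      using norm_adj_isometry_le[OF v, of "blinfun_apply r (blinfun_apply u h)"]
      by (simp add: fixed_apply[OF \<open>r \<in> R\<close>])
  next
    show "norm (blinfun_apply u h) = norm h" for h
      using u by (simp add: isometry_def)
  qed
  then have eq: "norm (blinfun_apply a (blinfun_apply u y)) = norm (blinfun_apply a y)"
    if "y = blinfun_apply (b\<^sup>\<star>) k" for y
    using c by (simp add: adj_b blinfun.scaleR_left blinfun.scaleR_right that)
  define y where "y = blinfun_apply (b\<^sup>\<star>) k"
  define w where "w = blinfun_apply a (blinfun_apply u y)"
  have nw: "norm w = norm (blinfun_apply a y)"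
    unfolding w_def by (rule eq[OF y_def])
  have nv: "norm (blinfun_apply v (blinfun_apply a y)) = norm (blinfun_apply a y)"
    using v by (simp add: isometry_def)
  have "inner (blinfun_apply v (blinfun_apply a y)) w = inner (blinfun_apply a y) (blinfun_apply a y)"
    using v by (simp add: inner_adj isometry_def w_def fixed_apply ab(1))
  \<comment> \<open>In the expanded square, both squared norms and the inner product equal the
    squared norm of \<open>a y\<close>.\<close>
  then have "(norm (w - blinfun_apply v (blinfun_apply a y)))\<^sup>2 = 0"
    using nw nv
    by (simp add: power2_norm_eq_inner norm_eq_sqrt_inner inner_diff_left inner_diff_right inner_commute)
  then show "blinfun_apply (a o\<^sub>L u o\<^sub>L b\<^sup>\<star>) k = blinfun_apply (v o\<^sub>L a o\<^sub>L b\<^sup>\<star>) k"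
    by (simp add: w_def y_def)
qed

section \<open>Nondegeneracy of irreducible triple morphisms\<close>

lemma common_kernel_projection:
  fixes F :: "('a::complex_hilbert \<Rightarrow>\<^sub>L 'b::complex_hilbert) set"
  assumes F: "F \<subseteq> bops"
  obtains p where "projection p" "\<And>f. f \<in> F \<Longrightarrow> f o\<^sub>L p = 0"
    "\<And>x. (\<And>f. f \<in> F \<Longrightarrow> blinfun_apply f x = 0) \<Longrightarrow> blinfun_apply p x = x"
proof -
  define N where "N = (\<Inter>f\<in>F. {x. blinfun_apply f x = 0})"
  have "closed {x. blinfun_apply f x = 0}" for f :: "'a \<Rightarrow>\<^sub>L 'b"
    by (intro closed_Collect_eq continuous_intros)
  then have "closed N"
    unfolding N_def by blast
  moreover have "complex_vector.subspace N"
    using F by (auto simp: N_def complex_vector.subspace_def blinfun.add_right bops_scaleC subset_iff)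
  ultimately obtain p where p: "projection p" "\<And>x. blinfun_apply p x \<in> N"
      "\<And>x. x \<in> N \<Longrightarrow> blinfun_apply p x = x"
    using projection_onto by blast
  show ?thesis
  proof
    show "projection p" by fact
    show "f o\<^sub>L p = 0" if "f \<in> F" for f
      using p(2) that by (auto simp: N_def intro!: blinfun_eqI)
    show "blinfun_apply p x = x" if "\<And>f. f \<in> F \<Longrightarrow> blinfun_apply f x = 0" for x
      using p(3)[of x] that by (simp add: N_def)
  qed
qed

text \<open>Taking adjoints of \<open>W o\<^sub>L f\<^sup>\<star> = 0\<close> places the range of
  \<open>W\<^sup>\<star>\<close> in the common kernel.\<close>

lemma eq_0_of_trivial_common_kernel:
  assumes W: "W \<in> bops" and "\<And>f. f \<in> F \<Longrightarrow> f \<in> bops" "\<And>f. f \<in> F \<Longrightarrow> W o\<^sub>L f\<^sup>\<star> = 0"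
    and kernel: "\<And>x. (\<And>f. f \<in> F \<Longrightarrow> blinfun_apply f x = 0) \<Longrightarrow> x = 0"
  shows "W = 0"
proof -
  have "blinfun_apply (W\<^sup>\<star>) y = 0" for y
  proof -
    have "blinfun_apply f (blinfun_apply (W\<^sup>\<star>) y) = 0" if "f \<in> F" for f
    proof -
      have "f o\<^sub>L W\<^sup>\<star> = (W o\<^sub>L f\<^sup>\<star>)\<^sup>\<star>"
        using assms(2)[OF that] W by (simp add: adj_compose)
      also have "\<dots> = 0"
        using assms(3)[OF that] by simp
      finally show ?thesis
        by (metis blinfun_apply_blinfun_compose zero_blinfun.rep_eq)
    qed
    from kernel[OF this] show ?thesis .
  qed
  then have "W\<^sup>\<star> = 0"
    by (intro blinfun_eqI) simp
  then show ?thesis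
    using adj_adj[OF W] by simp
qed

text \<open>Let \<open>p\<close> project onto the common kernel of all \<open>\<theta> t\<close>.
  The pair of \<open>p\<close> and the zero projection satisfies the intertwining relation, both
  sides being 0. Hence \<open>p\<close> is 0, and the ranges of the adjoints are total, or
  \<open>p\<close> is the identity, and \<theta> vanishes.\<close>

lemma irreducible_nondegenerate_right:
  assumes irr: "irreducible_triple_morphism T \<theta>"
    and W: "W \<in> bops" "\<And>t. t \<in> T \<Longrightarrow> W o\<^sub>L (\<theta> t)\<^sup>\<star> = 0"
  shows "W = 0 \<or> (\<forall>t\<in>T. \<theta> t = 0)"
proof -
  have \<theta>: "\<theta> ` T \<subseteq> bops"
    using irr by (simp add: irreducible_triple_morphism_def triple_morphism_def)
  obtain p where p: "projection p" "\<And>f. f \<in> \<theta> ` T \<Longrightarrow> f o\<^sub>L p = 0"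
      "\<And>x. (\<And>f. f \<in> \<theta> ` T \<Longrightarrow> blinfun_apply f x = 0) \<Longrightarrow> blinfun_apply p x = x"
    using common_kernel_projection[OF \<theta>] by blast
  have "projection (0 :: 'd \<Rightarrow>\<^sub>L 'd)"
    by (simp add: projection_def)
  moreover have "\<forall>t\<in>T. 0 o\<^sub>L \<theta> t = \<theta> t o\<^sub>L p"
    using p(2) by simp
  ultimately have "p = 0 \<or> p = id_blinfun"
    using irr p(1) unfolding irreducible_triple_morphism_def by blast
  then show ?thesis
  proof
    assume "p = 0"
    have "W = 0"
    proof (rule eq_0_of_trivial_common_kernel[OF W(1)])
      show "f \<in> bops" "W o\<^sub>L f\<^sup>\<star> = 0" if "f \<in> \<theta> ` T" for f
        using that W(2) \<theta> by auto
      show "x = 0" if "\<And>f. f \<in> \<theta> ` T \<Longrightarrow> blinfun_apply f x = 0" for x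
        using p(3)[OF that] \<open>p = 0\<close> by simp
    qed
    then show ?thesis ..
  next
    assume "p = id_blinfun"
    then show ?thesis
      using p(2) by auto
  qed
qed

text \<open>The mirror image: the zero projection is paired with the projection \<open>q\<close>
  onto the common kernel of the adjoints.\<close>

lemma irreducible_nondegenerate_left:
  assumes irr: "irreducible_triple_morphism T \<theta>"
    and W: "W \<in> bops" "\<And>t. t \<in> T \<Longrightarrow> W o\<^sub>L \<theta> t = 0"
  shows "W = 0 \<or> (\<forall>t\<in>T. \<theta> t = 0)"
proof -
  have \<theta>: "\<theta> t \<in> bops" if "t \<in> T" for t
    using irr that by (auto simp: irreducible_triple_morphism_def triple_morphism_def)
  let ?F = "(\<lambda>t. (\<theta> t)\<^sup>\<star>) ` T"
  have F: "?F \<subseteq> bops"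
    using \<theta> by auto
  obtain q where q: "projection q" "\<And>f. f \<in> ?F \<Longrightarrow> f o\<^sub>L q = 0"
      "\<And>x. (\<And>f. f \<in> ?F \<Longrightarrow> blinfun_apply f x = 0) \<Longrightarrow> blinfun_apply q x = x"
    using common_kernel_projection[OF F] by blast
  have q\<theta>: "q o\<^sub>L \<theta> t = 0" if "t \<in> T" for t
  proof -
    have "q o\<^sub>L \<theta> t = ((\<theta> t)\<^sup>\<star> o\<^sub>L q)\<^sup>\<star>"
      using q(1) \<theta>[OF that] by (simp add: adj_compose projection_def)
    then show ?thesis
      using q(2) that by simp
  qed
  have "projection (0 :: 'c \<Rightarrow>\<^sub>L 'c)"
    by (simp add: projection_def)
  moreover have "\<forall>t\<in>T. q o\<^sub>L \<theta> t = \<theta> t o\<^sub>L 0"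
    using q\<theta> by simp
  ultimately have "q = 0 \<or> q = id_blinfun"
    using irr q(1) unfolding irreducible_triple_morphism_def by blast
  then show ?thesis
  proof
    assume "q = 0"
    have "W = 0"
    proof (rule eq_0_of_trivial_common_kernel[OF W(1)])
      show "f \<in> bops" "W o\<^sub>L f\<^sup>\<star> = 0" if "f \<in> ?F" for f
        using that W(2) \<theta> by auto
      show "x = 0" if "\<And>f. f \<in> ?F \<Longrightarrow> blinfun_apply f x = 0" for x
        using q(3)[OF that] \<open>q = 0\<close> by simp
    qed
    then show ?thesis ..
  next
    assume "q = id_blinfun"
    then show ?thesis
      using q\<theta> by auto
  qed
qed

lemma triple_morphism_range:
  assumes "tro T" "triple_morphism T \<theta>"
  shows "\<theta> ` T \<subseteq> bops" "complex_vector.subspace (\<theta> ` T)"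
    "\<And>x y z. x \<in> \<theta> ` T \<Longrightarrow> y \<in> \<theta> ` T \<Longrightarrow> z \<in> \<theta> ` T \<Longrightarrow> x o\<^sub>L y\<^sup>\<star> o\<^sub>L z \<in> \<theta> ` T"
proof -
  show "\<theta> ` T \<subseteq> bops"
    using assms(2) by (simp add: triple_morphism_def)
  have T: "complex_vector.subspace T" and lin: "clinear_on T \<theta>"
    using assms by (simp_all add: tro_def triple_morphism_def)
  have "\<theta> 0 = 0"
    using lin T unfolding clinear_on_def
    by (metis complex_vector.scale_zero_left complex_vector.subspace_0)
  moreover have "\<theta> x + \<theta> y \<in> \<theta> ` T" "c *\<^sub>C \<theta> x \<in> \<theta> ` T" if "x \<in> T" "y \<in> T" for x y c
    using lin T that unfolding clinear_on_def
    by (metis complex_vector.subspace_add image_eqI, metis complex_vector.subspace_scale image_eqI)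
  ultimately show "complex_vector.subspace (\<theta> ` T)"
    using complex_vector.subspace_0[OF T] by (auto simp: complex_vector.subspace_def image_iff)
  show "x o\<^sub>L y\<^sup>\<star> o\<^sub>L z \<in> \<theta> ` T" if xyz: "x \<in> \<theta> ` T" "y \<in> \<theta> ` T" "z \<in> \<theta> ` T" for x y z
  proof -
    obtain x' y' z' where *: "x' \<in> T" "y' \<in> T" "z' \<in> T" "x = \<theta> x'" "y = \<theta> y'" "z = \<theta> z'"
      using xyz by auto
    then have "x o\<^sub>L y\<^sup>\<star> o\<^sub>L z = \<theta> (x' o\<^sub>L y'\<^sup>\<star> o\<^sub>L z')" "x' o\<^sub>L y'\<^sup>\<star> o\<^sub>L z' \<in> T"
      using assms by (auto simp: triple_morphism_def tro_def)
    then show ?thesis by auto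
  qed
qed

text \<open>Lets the intertwining lemma be applied with \<open>u\<close> and \<open>v\<close>
  exchanged; taking adjoints only reverses a ternary product.\<close>

lemma ternary_space_adj_image:
  fixes R :: "('h::complex_hilbert \<Rightarrow>\<^sub>L 'k::complex_hilbert) set"
  assumes bops: "R \<subseteq> bops" and sub: "complex_vector.subspace R"
    and ternary: "\<And>x y z. x \<in> R \<Longrightarrow> y \<in> R \<Longrightarrow> z \<in> R \<Longrightarrow> x o\<^sub>L y\<^sup>\<star> o\<^sub>L z \<in> R"
  shows "adj ` R \<subseteq> bops" "complex_vector.subspace (adj ` R)"
    "\<And>x y z. x \<in> adj ` R \<Longrightarrow> y \<in> adj ` R \<Longrightarrow> z \<in> adj ` R \<Longrightarrow> x o\<^sub>L y\<^sup>\<star> o\<^sub>L z \<in> adj ` R"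
proof -
  show "adj ` R \<subseteq> bops"
    using bops by auto
  have mem_iff: "x \<in> adj ` R \<longleftrightarrow> x \<in> bops \<and> x\<^sup>\<star> \<in> R" for x
    using bops by (auto simp: image_iff subset_iff) (metis adj_adj)
  show "complex_vector.subspace (adj ` R)"
    using sub by (auto simp: complex_vector.subspace_def mem_iff adj_add adj_scaleC)
  show "x o\<^sub>L y\<^sup>\<star> o\<^sub>L z \<in> adj ` R" if "x \<in> adj ` R" "y \<in> adj ` R" "z \<in> adj ` R" for x y z
    using that ternary[of "z\<^sup>\<star>" "y\<^sup>\<star>" "x\<^sup>\<star>"] by (simp add: mem_iff adj_compose comp_assoc)
qed

text \<open>Nondegeneracy cancels the right-hand factor left by the intertwining lemma; if \<theta>
  vanishes, both sides are 0. The second identity is not the adjoint of the first, which would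
  involve \<open>u\<^sup>\<star>\<close> and \<open>v\<^sup>\<star>\<close>, so the argument is
  repeated on the space of adjoints.\<close>

lemma irreducible_compression_fixed_intertwines:
  assumes T: "tro T" and irr: "irreducible_triple_morphism T \<theta>"
    and u: "isometry u" and v: "isometry v"
    and fixed: "\<And>t. t \<in> T \<Longrightarrow> v\<^sup>\<star> o\<^sub>L \<theta> t o\<^sub>L u = \<theta> t" and t: "t \<in> T"
  shows "\<theta> t o\<^sub>L u = v o\<^sub>L \<theta> t" "(\<theta> t)\<^sup>\<star> o\<^sub>L v = u o\<^sub>L (\<theta> t)\<^sup>\<star>"
proof -
  have "triple_morphism T \<theta>"
    using irr by (simp add: irreducible_triple_morphism_def)
  note R = triple_morphism_range[OF T this]
  have \<theta>: "\<theta> s \<in> bops" if "s \<in> T" for s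
    using R(1) that by auto
  have uv: "u \<in> bops" "v \<in> bops"
    using u v by (auto simp: isometry_def)
  have fixed_range: "v\<^sup>\<star> o\<^sub>L r o\<^sub>L u = r" if "r \<in> \<theta> ` T" for r
    using fixed that by auto
  have "((\<theta> t o\<^sub>L u) - (v o\<^sub>L \<theta> t)) o\<^sub>L (\<theta> s)\<^sup>\<star> = 0" if "s \<in> T" for s
    using compression_fixed_intertwines[OF R u v fixed_range, of "\<theta> t" "\<theta> s"] t that
    by (simp add: comp_diff_left)
  moreover have "(\<theta> t o\<^sub>L u) - (v o\<^sub>L \<theta> t) \<in> bops"
    using uv \<theta> t by simp
  ultimately have "(\<theta> t o\<^sub>L u) - (v o\<^sub>L \<theta> t) = 0 \<or> (\<forall>t\<in>T. \<theta> t = 0)"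
    using irreducible_nondegenerate_right[OF irr] by blast
  then show "\<theta> t o\<^sub>L u = v o\<^sub>L \<theta> t"
    using t by auto
  note R' = ternary_space_adj_image[OF R]
  have fixed': "u\<^sup>\<star> o\<^sub>L r o\<^sub>L v = r" if r: "r \<in> adj ` \<theta> ` T" for r
  proof -
    obtain s where s: "s \<in> T" "r = (\<theta> s)\<^sup>\<star>"
      using r by auto
    have "(v\<^sup>\<star> o\<^sub>L \<theta> s o\<^sub>L u)\<^sup>\<star> = u\<^sup>\<star> o\<^sub>L r o\<^sub>L v"
      using uv \<theta> s by (simp add: adj_compose comp_assoc)
    then show ?thesis
      using fixed s by simp
  qed
  have "(((\<theta> t)\<^sup>\<star> o\<^sub>L v) - (u o\<^sub>L (\<theta> t)\<^sup>\<star>)) o\<^sub>L \<theta> s = 0" if "s \<in> T" for s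
    using compression_fixed_intertwines[OF R' v u fixed', of "(\<theta> t)\<^sup>\<star>" "(\<theta> s)\<^sup>\<star>"] \<theta> t that
    by (simp add: comp_diff_left)
  moreover have "((\<theta> t)\<^sup>\<star> o\<^sub>L v) - (u o\<^sub>L (\<theta> t)\<^sup>\<star>) \<in> bops"
    using uv \<theta> t by simp
  ultimately have "((\<theta> t)\<^sup>\<star> o\<^sub>L v) - (u o\<^sub>L (\<theta> t)\<^sup>\<star>) = 0 \<or> (\<forall>t\<in>T. \<theta> t = 0)"
    using irreducible_nondegenerate_left[OF irr] by blast
  then show "(\<theta> t)\<^sup>\<star> o\<^sub>L v = u o\<^sub>L (\<theta> t)\<^sup>\<star>"
    using t by auto
qed


section \<open>Representations of the generated C*-algebra\<close>

instance complex_hilbert \<subseteq> banach ..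

text \<open>The root is \<open>1 - y\<close>, where \<open>y\<close> is the fixed point of the contraction \<open>y \<mapsto> (d + y\<^sup>2) / 2\<close>.\<close>

lemma square_root_one_minus:
  assumes A: "cstar_algebra A" and d: "d \<in> A" "d\<^sup>\<star> = d" "norm d < 1" and id: "id_blinfun \<in> A"
  shows "\<exists>r\<in>A. r\<^sup>\<star> = r \<and> r o\<^sub>L r = id_blinfun - d"
proof -
  have sub: "complex_vector.subspace A" and bops: "A \<subseteq> bops" and clo: "closed A"
    and mult: "\<And>a b. a \<in> A \<Longrightarrow> b \<in> A \<Longrightarrow> a o\<^sub>L b \<in> A"
    using A by (auto simp: cstar_algebra_def)
  have scale: "r *\<^sub>R a \<in> A" if "a \<in> A" for r a
    using that sub by (simp add: scaleR_scaleC complex_vector.subspace_scale)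
  \<comment> \<open>On this ball the map is a contraction with factor \<open>norm d\<close>, and it
    preserves the ball because \<open>norm d < 1\<close>. Membership in \<open>A\<close> and
    self-adjointness are closed conditions, so the fixed point inherits them.\<close>
  define S where "S = {y \<in> A. y\<^sup>\<star> = y \<and> norm y \<le> norm d}"
  define f where "f y = (1/2) *\<^sub>R (d + (y o\<^sub>L y))" for y
  have "complete S"
  proof -
    have "closed S"
    proof (unfold closed_sequential_limits, intro allI impI)
      fix X l
      assume X: "(\<forall>n. X n \<in> S) \<and> X \<longlonglongrightarrow> l"
      then have XA: "X n \<in> A" "(X n)\<^sup>\<star> = X n" "norm (X n) \<le> norm d" for n
        by (auto simp: S_def)
      then have "l \<in> A"
        using clo X unfolding closed_sequential_limits by blast
      have "(\<lambda>n. (X n)\<^sup>\<star>) \<longlonglongrightarrow> l\<^sup>\<star>"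
      proof (rule tendsto_adj)
        show "X n \<in> bops" for n
          using XA(1) bops by auto
        show "l \<in> bops" "X \<longlonglongrightarrow> l"
          using \<open>l \<in> A\<close> bops X by auto
      qed
      then have "X \<longlonglongrightarrow> l\<^sup>\<star>"
        by (simp add: XA(2))
      then have "l\<^sup>\<star> = l"
        using X LIMSEQ_unique by blast
      moreover have "norm l \<le> norm d"
        by (rule LIMSEQ_le_const2[OF tendsto_norm]) (use X XA(3) in auto)
      ultimately show "l \<in> S"
        using \<open>l \<in> A\<close> by (simp add: S_def)
    qed
    then show ?thesis
      by (simp add: complete_eq_closed)
  qed
  moreover have "S \<noteq> {}"
    using d by (auto simp: S_def)
  moreover have "f ` S \<subseteq> S"
  proof (rule image_subsetI)
    fix y
    assume "y \<in> S"
    then have y: "y \<in> A" "y\<^sup>\<star> = y" "norm y \<le> norm d"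
      by (auto simp: S_def)
    have "f y \<in> A"
      using y(1) d(1) sub by (simp add: f_def scale mult complex_vector.subspace_add)
    moreover have "(f y)\<^sup>\<star> = f y"
      using y d bops by (auto simp: f_def scaleR_scaleC adj_scaleC adj_add adj_compose subset_iff)
    moreover have "norm (f y) \<le> norm d"
    proof -
      have "norm (d + (y o\<^sub>L y)) \<le> norm d + norm y * norm y"
        by (rule order_trans[OF norm_triangle_ineq add_left_mono[OF norm_blinfun_compose]])
      also have "\<dots> \<le> norm d + 1 * norm d"
        using y(3) d(3) by (intro add_left_mono mult_mono) auto
      finally show ?thesis
        by (simp add: f_def)
    qed
    ultimately show "f y \<in> S"
      by (simp add: S_def)
  qed
  moreover have "dist (f y) (f z) \<le> norm d * dist y z" if "y \<in> S" "z \<in> S" for y z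
  proof -
    \<comment> \<open>The difference of two squares, split without commutativity.\<close>
    have "f y - f z = (1/2) *\<^sub>R ((y o\<^sub>L (y - z)) + ((y - z) o\<^sub>L z))"
      by (simp add: f_def comp_diff_left comp_diff_right flip: scaleR_diff_right)
    then have "norm (f y - f z) = norm ((y o\<^sub>L (y - z)) + ((y - z) o\<^sub>L z)) / 2"
      by simp
    also have "\<dots> \<le> (norm y * norm (y - z) + norm (y - z) * norm z) / 2"
      by (intro divide_right_mono order_trans[OF norm_triangle_ineq] add_mono norm_blinfun_compose) auto
    also have "\<dots> \<le> (norm d * norm (y - z) + norm (y - z) * norm d) / 2"
      using that by (intro divide_right_mono add_mono mult_mono) (auto simp: S_def)
    finally show ?thesis
      by (simp add: dist_norm)
  qed
  ultimately obtain y where y: "y \<in> S" "f y = y"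
    using Banach_fix[of S "norm d" f] d(3) by auto
  \<comment> \<open>The fixed point equation reads \<open>2 y = d + y^2\<close>, which is
    \<open>(1 - y)^2 = 1 - d\<close>.\<close>
  have "y + y = (f y) + (f y)"
    using y(2) by simp
  also have "\<dots> = d + (y o\<^sub>L y)"
    by (simp add: f_def flip: scaleR_left_distrib)
  finally have yy: "y o\<^sub>L y = y + y - d"
    by simp
  have "id_blinfun - y \<in> A"
    using y(1) id sub by (simp add: S_def complex_vector.subspace_diff)
  moreover have "(id_blinfun - y)\<^sup>\<star> = id_blinfun - y"
    using y(1) bops by (auto simp: S_def adj_diff)
  moreover have "(id_blinfun - y) o\<^sub>L (id_blinfun - y) = id_blinfun - d"
    by (simp add: comp_diff_left comp_diff_right yy)
  ultimately show ?thesis by blast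
qed

text \<open>For \<open>\<parallel>b\<parallel> < 1\<close>, writing \<open>1 - b\<^sup>\<star>b = r\<^sup>2\<close> gives \<open>1 - \<omega>(b)\<^sup>\<star>\<omega>(b) = \<omega>(r)\<^sup>\<star>\<omega>(r) \<ge> 0\<close>.\<close>

lemma star_representation_norm_le:
  assumes A: "cstar_algebra A" "id_blinfun \<in> A" and \<omega>: "star_representation A \<omega>" "\<omega> id_blinfun = id_blinfun"
    and a: "a \<in> A"
  shows "norm (\<omega> a) \<le> norm a"
proof (rule dense_ge)
  fix c
  assume c: "norm a < c"
  then have "c > 0"
    using norm_ge_zero[of a] by linarith
  have bops: "A \<subseteq> bops" and star: "\<And>a. a \<in> A \<Longrightarrow> a\<^sup>\<star> \<in> A"
    and mult: "\<And>a b. a \<in> A \<Longrightarrow> b \<in> A \<Longrightarrow> a o\<^sub>L b \<in> A" and sub: "complex_vector.subspace A"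
    using A(1) by (auto simp: cstar_algebra_def)
  have \<omega>_bops: "\<And>a. a \<in> A \<Longrightarrow> \<omega> a \<in> bops"
    and \<omega>_add: "\<And>a b. a \<in> A \<Longrightarrow> b \<in> A \<Longrightarrow> \<omega> (a + b) = \<omega> a + \<omega> b"
    and \<omega>_scale: "\<And>c a. a \<in> A \<Longrightarrow> \<omega> (c *\<^sub>C a) = c *\<^sub>C \<omega> a"
    and \<omega>_mult: "\<And>a b. a \<in> A \<Longrightarrow> b \<in> A \<Longrightarrow> \<omega> (a o\<^sub>L b) = \<omega> a o\<^sub>L \<omega> b"
    and \<omega>_star: "\<And>a. a \<in> A \<Longrightarrow> \<omega> (a\<^sup>\<star>) = (\<omega> a)\<^sup>\<star>"
    using \<omega>(1) by (auto simp: star_representation_def clinear_on_def)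
  \<comment> \<open>Dividing by some \<open>c\<close> strictly above \<open>norm a\<close> gives
    norm below 1, as the square root requires; \<open>c\<close> may then decrease to
    \<open>norm a\<close>.\<close>
  define b where "b = (1 / c) *\<^sub>R a"
  have b: "b \<in> A" "b \<in> bops"
    using a bops sub by (auto simp: b_def scaleR_scaleC complex_vector.subspace_scale subset_iff)
  have nb: "norm b < 1"
    using c \<open>c > 0\<close> by (simp add: b_def)
  define d where "d = b\<^sup>\<star> o\<^sub>L b"
  have d: "d \<in> A" "d\<^sup>\<star> = d"
    using b star mult by (auto simp: d_def adj_compose)
  have "norm d \<le> norm b * norm b"
    unfolding d_def by (rule order_trans[OF norm_blinfun_compose]) (simp add: norm_adj b)
  also have "\<dots> \<le> 1 * norm b"
    using nb by (intro mult_right_mono) auto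
  finally have "norm d < 1"
    using nb by simp
  then obtain r where r: "r \<in> A" "r\<^sup>\<star> = r" "r o\<^sub>L r = id_blinfun - d"
    using square_root_one_minus[OF A(1) d] A(2) by blast
  have "id_blinfun = \<omega> (d + (r o\<^sub>L r))"
    using r(3) \<omega>(2) by simp
  also have "\<dots> = ((\<omega> b)\<^sup>\<star> o\<^sub>L \<omega> b) + ((\<omega> r)\<^sup>\<star> o\<^sub>L \<omega> r)"
    using r(1,2) b d mult star by (simp add: \<omega>_add \<omega>_mult d_def flip: \<omega>_star)
  finally have id_eq: "((\<omega> b)\<^sup>\<star> o\<^sub>L \<omega> b) + ((\<omega> r)\<^sup>\<star> o\<^sub>L \<omega> r) = id_blinfun" ..
  have "norm (\<omega> b) \<le> 1"
  proof (rule norm_blinfun_bound)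
    fix x
    have "(norm (blinfun_apply (\<omega> b) x))\<^sup>2 + (norm (blinfun_apply (\<omega> r) x))\<^sup>2
        = inner x (blinfun_apply (((\<omega> b)\<^sup>\<star> o\<^sub>L \<omega> b) + ((\<omega> r)\<^sup>\<star> o\<^sub>L \<omega> r)) x)"
      using b r by (simp add: power2_norm_eq_inner inner_adj \<omega>_bops blinfun.add_left inner_add_right)
    also have "\<dots> = (norm x)\<^sup>2"
      by (simp add: id_eq power2_norm_eq_inner)
    finally have "(norm (blinfun_apply (\<omega> b) x))\<^sup>2 \<le> (norm x)\<^sup>2"
      by (smt (verit) zero_le_power2)
    then have "norm (blinfun_apply (\<omega> b) x) \<le> norm x"
      by (rule power2_le_imp_le) simp
    then show "norm (blinfun_apply (\<omega> b) x) \<le> 1 * norm x"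
      by simp
  qed simp
  moreover have "\<omega> b = (1 / c) *\<^sub>R \<omega> a"
    by (simp only: b_def scaleR_scaleC \<omega>_scale[OF a])
  ultimately show "norm (\<omega> a) \<le> c"
    using \<open>c > 0\<close> by (simp add: divide_simps)
qed

text \<open>The elements \<open>a\<close> such that \<open>V\<close> commutes with both
  \<open>\<omega> a\<close> and \<open>\<omega> (a\<^sup>\<star>)\<close> form a C*-algebra
  containing \<open>S\<close>. Both conditions are imposed because commutation with one operator
  does not pass to its adjoint for a general \<open>V\<close>.\<close>

lemma star_representation_commute_generated:
  assumes S: "S \<subseteq> bops" and V: "V \<in> bops" and id: "id_blinfun \<in> cstar_generated S"
    and \<omega>: "star_representation (cstar_generated S) \<omega>" "\<omega> id_blinfun = id_blinfun"
    and comm: "\<And>s. s \<in> S \<Longrightarrow> V o\<^sub>L \<omega> s = \<omega> s o\<^sub>L V" "\<And>s. s \<in> S \<Longrightarrow> V o\<^sub>L \<omega> (s\<^sup>\<star>) = \<omega> (s\<^sup>\<star>) o\<^sub>L V"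
    and a: "a \<in> cstar_generated S"
  shows "V o\<^sub>L \<omega> a = \<omega> a o\<^sub>L V"
proof -
  define A where "A = cstar_generated S"
  define B where "B = {a \<in> A. V o\<^sub>L \<omega> a = \<omega> a o\<^sub>L V \<and> V o\<^sub>L \<omega> (a\<^sup>\<star>) = \<omega> (a\<^sup>\<star>) o\<^sub>L V}"
  have A: "cstar_algebra A"
    unfolding A_def by (rule cstar_algebra_generated[OF S])
  have bops: "\<And>a. a \<in> A \<Longrightarrow> a \<in> bops" and star: "\<And>a. a \<in> A \<Longrightarrow> a\<^sup>\<star> \<in> A" and clo: "closed A"
    and mult: "\<And>a b. a \<in> A \<Longrightarrow> b \<in> A \<Longrightarrow> a o\<^sub>L b \<in> A" and sub: "complex_vector.subspace A"
    using A by (auto simp: cstar_algebra_def)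
  have \<omega>_bops: "\<And>a. a \<in> A \<Longrightarrow> \<omega> a \<in> bops"
    and \<omega>_add: "\<And>a b. a \<in> A \<Longrightarrow> b \<in> A \<Longrightarrow> \<omega> (a + b) = \<omega> a + \<omega> b"
    and \<omega>_scale: "\<And>c a. a \<in> A \<Longrightarrow> \<omega> (c *\<^sub>C a) = c *\<^sub>C \<omega> a"
    and \<omega>_mult: "\<And>a b. a \<in> A \<Longrightarrow> b \<in> A \<Longrightarrow> \<omega> (a o\<^sub>L b) = \<omega> a o\<^sub>L \<omega> b"
    using \<omega>(1) by (auto simp: star_representation_def clinear_on_def A_def)
  have \<omega>_diff: "\<omega> (a - b) = \<omega> a - \<omega> b" if "a \<in> A" "b \<in> A" for a b
    using \<omega>_add[of "a - b" b] that sub by (simp add: complex_vector.subspace_diff)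
  \<comment> \<open>Contractivity of \<omega>, applied to \<open>X n - l\<close>, gives the
    continuity behind closedness of \<open>B\<close>.\<close>
  have \<omega>_tendsto: "(\<lambda>n. \<omega> (X n)) \<longlonglongrightarrow> \<omega> l" if X: "\<And>n. X n \<in> A" "l \<in> A" "X \<longlonglongrightarrow> l" for X l
  proof (rule LIM_zero_cancel, rule Lim_null_comparison)
    show "(\<lambda>n. norm (X n - l)) \<longlonglongrightarrow> 0"
      using X(3) by (simp add: LIM_zero tendsto_norm_zero)
    have "norm (\<omega> (X n) - \<omega> l) \<le> norm (X n - l)" for n
      using star_representation_norm_le[OF A _ \<omega>[folded A_def], of "X n - l"] id X sub
      by (simp add: \<omega>_diff A_def complex_vector.subspace_diff)
    then show "\<forall>\<^sub>F n in sequentially. norm (\<omega> (X n) - \<omega> l) \<le> norm (X n - l)"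
      by simp
  qed
  have comm_tendsto: "V o\<^sub>L \<omega> l = \<omega> l o\<^sub>L V"
    if X: "\<And>n. X n \<in> A" "l \<in> A" "X \<longlonglongrightarrow> l" and c: "\<And>n. V o\<^sub>L \<omega> (X n) = \<omega> (X n) o\<^sub>L V" for X l
  proof (rule LIMSEQ_unique)
    show "(\<lambda>n. V o\<^sub>L \<omega> (X n)) \<longlonglongrightarrow> (V o\<^sub>L \<omega> l)"
      by (intro bounded_bilinear.tendsto[OF bounded_bilinear_blinfun_compose] tendsto_const \<omega>_tendsto X)
    show "(\<lambda>n. V o\<^sub>L \<omega> (X n)) \<longlonglongrightarrow> (\<omega> l o\<^sub>L V)"
      unfolding c
      by (intro bounded_bilinear.tendsto[OF bounded_bilinear_blinfun_compose] tendsto_const \<omega>_tendsto X)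
  qed
  have comm_mult: "V o\<^sub>L \<omega> (a o\<^sub>L b) = \<omega> (a o\<^sub>L b) o\<^sub>L V"
    if "a \<in> A" "b \<in> A" "V o\<^sub>L \<omega> a = \<omega> a o\<^sub>L V" "V o\<^sub>L \<omega> b = \<omega> b o\<^sub>L V" for a b
    by (metis \<omega>_mult comp_assoc that)
  have comm_scale: "V o\<^sub>L \<omega> (c *\<^sub>C a) = \<omega> (c *\<^sub>C a) o\<^sub>L V"
    if a: "a \<in> A" "V o\<^sub>L \<omega> a = \<omega> a o\<^sub>L V" for a c
  proof -
    have "V o\<^sub>L (c *\<^sub>C \<omega> a) = c *\<^sub>C (V o\<^sub>L \<omega> a)"
      by (rule blinfun_eqI) (simp add: bops_scaleC[OF V])
    moreover have "(c *\<^sub>C \<omega> a) o\<^sub>L V = c *\<^sub>C (\<omega> a o\<^sub>L V)"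
      by (rule blinfun_eqI) simp
    ultimately show ?thesis
      by (simp add: \<omega>_scale a)
  qed
  have "cstar_algebra B"
    unfolding cstar_algebra_def
  proof (intro conjI ballI)
    show "B \<subseteq> bops"
      using bops by (auto simp: B_def)
    have zero: "0 \<in> A" "\<omega> 0 = 0"
      using sub \<omega>_diff[of 0 0] by (simp_all add: complex_vector.subspace_0)
    show "complex_vector.subspace B"
    proof (rule complex_vector.subspaceI)
      show "0 \<in> B"
        using zero by (simp add: B_def)
      show "x + y \<in> B" if "x \<in> B" "y \<in> B" for x y
        using that sub star bops
        by (simp add: B_def complex_vector.subspace_add adj_add \<omega>_add comp_add_left comp_add_right)
      show "c *\<^sub>C x \<in> B" if "x \<in> B" for c x
        using that sub star bops
        by (simp add: B_def complex_vector.subspace_scale adj_scaleC comm_scale)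
    qed
    show "closed B"
    proof (unfold closed_sequential_limits, intro allI impI)
      fix X l
      assume X: "(\<forall>n. X n \<in> B) \<and> X \<longlonglongrightarrow> l"
      have XA: "X n \<in> A" "V o\<^sub>L \<omega> (X n) = \<omega> (X n) o\<^sub>L V"
          "V o\<^sub>L \<omega> ((X n)\<^sup>\<star>) = \<omega> ((X n)\<^sup>\<star>) o\<^sub>L V" for n
        using X by (auto simp: B_def)
      have l: "l \<in> A"
        using clo X XA(1) unfolding closed_sequential_limits by blast
      have "(\<lambda>n. (X n)\<^sup>\<star>) \<longlonglongrightarrow> l\<^sup>\<star>"
        by (rule tendsto_adj) (use X XA(1) l bops in auto)
      then have "V o\<^sub>L \<omega> (l\<^sup>\<star>) = \<omega> (l\<^sup>\<star>) o\<^sub>L V"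
        by (rule comm_tendsto[rotated 2]) (use XA star l in auto)
      moreover have "V o\<^sub>L \<omega> l = \<omega> l o\<^sub>L V"
        by (rule comm_tendsto[of X]) (use X XA l in auto)
      ultimately show "l \<in> B"
        using l by (simp add: B_def)
    qed
    show "x o\<^sub>L y \<in> B" if "x \<in> B" "y \<in> B" for x y
      using that by (simp add: B_def mult comm_mult star bops adj_compose)
    show "x\<^sup>\<star> \<in> B" if "x \<in> B" for x
      using that by (simp add: B_def star bops)
  qed
  moreover have "S \<subseteq> B"
    using comm hull_subset[of S cstar_algebra] by (auto simp: B_def A_def cstar_generated_def)
  ultimately have "A \<subseteq> B"
    unfolding A_def cstar_generated_def by (intro hull_minimal)
  then show ?thesis
    using a by (auto simp: A_def B_def)
qed


section \<open>The Paulsen system\<close>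

lemma paulsen_system_memI:
  "x \<in> X \<Longrightarrow> y \<in> X \<Longrightarrow> block (\<alpha> *\<^sub>C id_blinfun) x (y\<^sup>\<star>) (\<beta> *\<^sub>C id_blinfun) \<in> paulsen_system X"
  unfolding paulsen_system_def by blast

lemma paulsen_system_bops: "X \<subseteq> bops \<Longrightarrow> paulsen_system X \<subseteq> bops"
  by (auto simp: paulsen_system_def block_bops_iff subset_iff)

text \<open>The operators whose corner lies in the algebra form a TRO containing \<open>X\<close>:
  the corner of a ternary product is the product of the corners, the middle one adjoined.\<close>

lemma paulsen_corner:
  assumes X: "operator_space X" and t: "t \<in> tro hull X"
  shows "block 0 t 0 0 \<in> cstar_generated (paulsen_system X)"
proof -
  define A where "A = cstar_generated (paulsen_system X)"
  have X': "X \<subseteq> bops" "0 \<in> X"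
    using X by (auto simp: operator_space_def complex_vector.subspace_0)
  have A: "cstar_algebra A"
    unfolding A_def by (intro cstar_algebra_generated paulsen_system_bops X')
  have star: "\<And>a. a \<in> A \<Longrightarrow> a\<^sup>\<star> \<in> A" and clo: "closed A"
    and mult: "\<And>a b. a \<in> A \<Longrightarrow> b \<in> A \<Longrightarrow> a o\<^sub>L b \<in> A" and sub: "complex_vector.subspace A"
    using A by (auto simp: cstar_algebra_def)
  define C where "C = {t \<in> bops. block 0 t 0 0 \<in> A}"
  have "tro C"
    unfolding tro_def
  proof (intro conjI ballI)
    show "C \<subseteq> bops"
      by (auto simp: C_def)
    show "complex_vector.subspace C"
    proof (rule complex_vector.subspaceI)
      show "0 \<in> C"
        using sub by (simp add: C_def block_zero complex_vector.subspace_0)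
      show "x + y \<in> C" if "x \<in> C" "y \<in> C" for x y
        using that complex_vector.subspace_add[OF sub, of "block 0 x 0 0" "block 0 y 0 0"]
        by (simp add: C_def block_add)
      show "c *\<^sub>C x \<in> C" if "x \<in> C" for c x
        using that complex_vector.subspace_scale[OF sub, of "block 0 x 0 0" c]
        by (simp add: C_def block_scaleC)
    qed
    have "closed (bops \<inter> (\<lambda>t. block 0 t 0 0) -` A)"
      by (intro closed_Int closed_bops closed_vimage clo
          bounded_linear.continuous_on[OF bounded_linear_block_corner] continuous_on_id)
    then show "closed C"
      by (simp add: C_def Int_def vimage_def)
    show "x o\<^sub>L y\<^sup>\<star> o\<^sub>L z \<in> C" if "x \<in> C" "y \<in> C" "z \<in> C" for x y z
    proof -
      have bops: "x \<in> bops" "y \<in> bops" "z \<in> bops"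
        using that by (auto simp: C_def)
      have "block 0 x 0 0 o\<^sub>L (block 0 y 0 0)\<^sup>\<star> o\<^sub>L block 0 z 0 0 \<in> A"
        using that by (intro mult star) (auto simp: C_def)
      then show ?thesis
        using bops by (simp add: C_def adj_block block_comp)
    qed
  qed
  moreover have "X \<subseteq> C"
  proof
    fix x
    assume x: "x \<in> X"
    \<comment> \<open>Zero scalars and a zero lower left entry are available because
      \<open>0 \<in> X\<close>.\<close>
    have "block (0 *\<^sub>C id_blinfun) x (0\<^sup>\<star>) (0 *\<^sub>C id_blinfun) \<in> A"
      unfolding A_def cstar_generated_def
      by (intro hull_inc paulsen_system_memI x X')
    then show "x \<in> C"
      using x X' by (auto simp: C_def)
  qed
  ultimately have "tro hull X \<subseteq> C"
    by (intro hull_minimal)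
  then show ?thesis
    using t by (auto simp: C_def A_def)
qed

lemma corresponding_representation_block:
  assumes "tro T" and \<theta>: "triple_morphism T \<theta>" and "corresponding_representation X T \<theta> \<omega>"
    and "x \<in> T" "y \<in> T"
  shows "\<omega> (block (\<alpha> *\<^sub>C id_blinfun) x (y\<^sup>\<star>) (\<beta> *\<^sub>C id_blinfun)) =
    block (\<alpha> *\<^sub>C id_blinfun) (\<theta> x) ((\<theta> y)\<^sup>\<star>) (\<beta> *\<^sub>C id_blinfun)"
proof -
  have T0: "0 \<in> T"
    using assms(1) by (simp add: tro_def complex_vector.subspace_0)
  have "\<theta> (0 *\<^sub>C 0) = 0 *\<^sub>C \<theta> 0"
    using \<theta> T0 unfolding triple_morphism_def clinear_on_def by blast
  then have \<theta>0: "\<theta> 0 = 0"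
    by simp
  have alg: "0 \<in> left_alg T" "0 \<in> right_alg T"
    unfolding left_alg_def right_alg_def using closure_subset complex_vector.span_zero by blast+
  obtain \<omega>\<^sub>1 \<omega>\<^sub>2 where \<omega>1: "\<forall>x\<in>T. \<forall>y\<in>T. \<omega>\<^sub>1 (x o\<^sub>L y\<^sup>\<star>) = \<theta> x o\<^sub>L (\<theta> y)\<^sup>\<star>"
    and \<omega>2: "\<forall>x\<in>T. \<forall>y\<in>T. \<omega>\<^sub>2 (x\<^sup>\<star> o\<^sub>L y) = (\<theta> x)\<^sup>\<star> o\<^sub>L \<theta> y"
    and \<omega>: "\<forall>a\<in>left_alg T. \<forall>b\<in>right_alg T. \<forall>x\<in>T. \<forall>y\<in>T. \<forall>\<alpha> \<beta>.
        \<omega> (block (a + \<alpha> *\<^sub>C id_blinfun) x (y\<^sup>\<star>) (b + \<beta> *\<^sub>C id_blinfun)) =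
        block (\<omega>\<^sub>1 a + \<alpha> *\<^sub>C id_blinfun) (\<theta> x) ((\<theta> y)\<^sup>\<star>) (\<omega>\<^sub>2 b + \<beta> *\<^sub>C id_blinfun)"
    using assms(3) unfolding corresponding_representation_def by blast
  \<comment> \<open>The maps on the diagonal are not assumed linear; their vanishing at 0 comes from
    writing 0 as a product of zero operators.\<close>
  have "\<omega>\<^sub>1 0 = 0" "\<omega>\<^sub>2 0 = 0"
    using \<omega>1[rule_format, OF T0 T0] \<omega>2[rule_format, OF T0 T0] by (simp_all add: \<theta>0)
  then show ?thesis
    using \<omega>[rule_format, OF alg assms(4,5), of \<alpha> \<beta>] by simp
qed

theorem proposition4p3:
  fixes X T :: "('h0::complex_hilbert \<Rightarrow>\<^sub>L 'k0::complex_hilbert) set"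
    and \<theta> :: "('h0 \<Rightarrow>\<^sub>L 'k0) \<Rightarrow> ('h::complex_hilbert \<Rightarrow>\<^sub>L 'k::complex_hilbert)"
    and \<omega> :: "(('k0 \<times> 'h0) \<Rightarrow>\<^sub>L ('k0 \<times> 'h0)) \<Rightarrow> (('k \<times> 'h) \<Rightarrow>\<^sub>L ('k \<times> 'h))"
  assumes "operator_space X"
    and "T = tro hull X"
    and "weak_boundary_triple_morphism X T \<theta>"
    and "corresponding_representation X T \<theta> \<omega>"
  shows "weak_boundary_star_representation (paulsen_system X) \<omega>"
proof -
  have X: "X \<subseteq> bops" "0 \<in> X"
    using assms(1) by (auto simp: operator_space_def complex_vector.subspace_0)
  have XT: "X \<subseteq> T"
    unfolding assms(2) by (rule hull_subset)
  have T: "tro T"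
    unfolding assms(2) by (rule tro_hull[OF X(1)])
  have T0: "0 \<in> T"
    using XT X(2) by auto
  have T_bops: "t \<in> bops" if "t \<in> T" for t
    using that T by (auto simp: tro_def)
  have irr: "irreducible_triple_morphism T \<theta>"
    using assms(3) by (simp add: weak_boundary_triple_morphism_def)
  then have \<theta>: "triple_morphism T \<theta>"
    by (simp add: irreducible_triple_morphism_def)
  have \<theta>_bops: "\<theta> t \<in> bops" if "t \<in> T" for t
    using \<theta> that by (auto simp: triple_morphism_def)
  define S where "S = paulsen_system X"
  define A where "A = cstar_generated S"
  have S: "S \<subseteq> bops"
    unfolding S_def by (rule paulsen_system_bops[OF X(1)])
  have SA: "S \<subseteq> A"
    unfolding A_def cstar_generated_def by (rule hull_subset)
  have \<omega>: "star_representation A \<omega>" "\<omega> id_blinfun = id_blinfun"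
    using assms(4) by (simp_all add: corresponding_representation_def A_def S_def)
  note \<omega>_block = corresponding_representation_block[OF T \<theta> assms(4)]
  have \<theta>0: "\<theta> 0 = 0"
    using complex_vector.subspace_0 \<theta> T0 unfolding triple_morphism_def clinear_on_def
    by (metis complex_vector.scale_zero_left)
  have diag: "block (\<alpha> *\<^sub>C id_blinfun) 0 0 (\<beta> *\<^sub>C id_blinfun) \<in> S" for \<alpha> \<beta>
    using paulsen_system_memI[OF X(2) X(2), of \<alpha> \<beta>] by (simp add: S_def)
  \<comment> \<open>The two coordinate projections of the direct sum; operators are shown to be
    diagonal by testing against them.\<close>
  have E: "block id_blinfun 0 0 0 \<in> S" and F: "block 0 0 0 id_blinfun \<in> S"
    and id: "id_blinfun \<in> S"
    using diag[of 1 0] diag[of 0 1] diag[of 1 1] by (simp_all add: block_id)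
  have \<omega>_diag: "\<omega> (block (\<alpha> *\<^sub>C id_blinfun) 0 0 (\<beta> *\<^sub>C id_blinfun)) = block (\<alpha> *\<^sub>C id_blinfun) 0 0 (\<beta> *\<^sub>C id_blinfun)" for \<alpha> \<beta>
    using \<omega>_block[OF T0 T0, of \<alpha> \<beta>] by (simp add: \<theta>0)
  have \<omega>E: "\<omega> (block id_blinfun 0 0 0) = block id_blinfun 0 0 0"
    and \<omega>F: "\<omega> (block 0 0 0 id_blinfun) = block 0 0 0 id_blinfun"
    using \<omega>_diag[of 1 0] \<omega>_diag[of 0 1] by simp_all
  have \<omega>_corner: "\<omega> (block 0 t 0 0) = block 0 (\<theta> t) 0 0" if "t \<in> T" for t
    using \<omega>_block[OF that T0, of 0 0] by (simp add: \<theta>0)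
  have corner: "block 0 t 0 0 \<in> A" if "t \<in> T" for t
    using paulsen_corner[OF assms(1)] that by (simp add: A_def S_def assms(2))
  \<comment> \<open>Commuting with a coordinate projection makes \<open>p\<close> diagonal; its
    entries are projections, and the corners reduce the claim to irreducibility of \<theta>.\<close>
  have irreducible: "p = 0 \<or> p = id_blinfun"
    if p: "projection p" and comm: "\<forall>a\<in>A. p o\<^sub>L \<omega> a = \<omega> a o\<^sub>L p" for p
  proof -
    obtain q x z p' where p_eq: "p = block q x z p'"
      by (rule block_cases)
    have "block q x z p' o\<^sub>L block id_blinfun 0 0 0 = block id_blinfun 0 0 0 o\<^sub>L block q x z p'"
      using comm E SA \<omega>E p_eq by fastforce
    then have xz: "x = 0" "z = 0"
      by (simp_all add: block_comp block_eq_iff)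
    have "q \<in> bops" "p' \<in> bops"
      using p by (simp_all add: projection_def p_eq xz block_bops_iff)
    then have "projection q" "projection p'"
      using p by (simp_all add: projection_def p_eq xz adj_block block_comp block_eq_iff)
    moreover have "q o\<^sub>L \<theta> t = \<theta> t o\<^sub>L p'" if "t \<in> T" for t
    proof -
      have "p o\<^sub>L \<omega> (block 0 t 0 0) = \<omega> (block 0 t 0 0) o\<^sub>L p"
        using comm corner[OF that] by blast
      then show ?thesis
        by (simp add: \<omega>_corner[OF that] p_eq xz block_comp block_eq_iff)
    qed
    ultimately have "q = 0 \<and> p' = 0 \<or> q = id_blinfun \<and> p' = id_blinfun"
      using irr unfolding irreducible_triple_morphism_def by blast
    then show ?thesis
      by (auto simp: p_eq xz block_zero block_id)
  qed
  have unique: "V\<^sup>\<star> o\<^sub>L \<omega> a o\<^sub>L V = \<omega> a"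
    if V: "isometry V" and fixed: "\<forall>s\<in>S. V\<^sup>\<star> o\<^sub>L \<omega> s o\<^sub>L V = \<omega> s" and a: "a \<in> A" for V a
  proof -
    obtain v x z u where V_eq: "V = block v x z u"
      by (rule block_cases)
    have bops: "v \<in> bops" "x \<in> bops" "z \<in> bops" "u \<in> bops"
      using V by (simp_all add: isometry_def V_eq block_bops_iff)
    have "V\<^sup>\<star> o\<^sub>L block id_blinfun 0 0 0 o\<^sub>L V = block id_blinfun 0 0 0"
      "V\<^sup>\<star> o\<^sub>L block 0 0 0 id_blinfun o\<^sub>L V = block 0 0 0 id_blinfun"
      using fixed[rule_format, OF E] fixed[rule_format, OF F] by (simp_all add: \<omega>E \<omega>F)
    \<comment> \<open>Diagonal entries of the two compressions: the first gives the relations for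
      \<open>v\<close> and \<open>x\<close>, the second those for \<open>z\<close> and
      \<open>u\<close>. Positivity then eliminates \<open>x\<close> and \<open>z\<close>.\<close>
    then have *: "v\<^sup>\<star> o\<^sub>L v = id_blinfun" "x\<^sup>\<star> o\<^sub>L x = 0" "z\<^sup>\<star> o\<^sub>L z = 0" "u\<^sup>\<star> o\<^sub>L u = id_blinfun"
      by (simp_all add: V_eq adj_block bops block_comp block_eq_iff)
    have V_diag: "V = block v 0 0 u"
      using adj_comp_eq_0[OF bops(2) *(2)] adj_comp_eq_0[OF bops(3) *(3)] by (simp add: V_eq)
    have uv: "isometry u" "isometry v"
      using * bops by (auto intro: isometryI)
    have "v\<^sup>\<star> o\<^sub>L \<theta> x o\<^sub>L u = \<theta> x" if "x \<in> X" for x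
    proof -
      have "block 0 x 0 0 \<in> S"
        using paulsen_system_memI[OF that X(2), of 0 0] by (simp add: S_def)
      from fixed[rule_format, OF this] show ?thesis
        using that XT by (auto simp: \<omega>_corner V_diag adj_block bops block_comp block_eq_iff)
    qed
    then have fixed_T: "v\<^sup>\<star> o\<^sub>L \<theta> t o\<^sub>L u = \<theta> t" if "t \<in> T" for t
      using assms(3) uv that unfolding weak_boundary_triple_morphism_def by blast
    note intertwine = irreducible_compression_fixed_intertwines[OF T irr uv fixed_T]
    have scale: "v o\<^sub>L (c *\<^sub>C id_blinfun) = (c *\<^sub>C id_blinfun) o\<^sub>L v" "u o\<^sub>L (c *\<^sub>C id_blinfun) = (c *\<^sub>C id_blinfun) o\<^sub>L u" for c
      by (auto intro!: blinfun_eqI simp: bops_scaleC bops)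
    \<comment> \<open>Off the diagonal the products agree by the two intertwining identities, on it
      because scalars commute with \<open>u\<close> and \<open>v\<close>. Taking adjoints exchanges
      \<open>x\<close> and \<open>y\<close>, so \<open>S\<close> is self-adjoint and both
      commutation conditions on generators hold.\<close>
    have comm: "V o\<^sub>L \<omega> s = \<omega> s o\<^sub>L V" "s\<^sup>\<star> \<in> S" if "s \<in> S" for s
    proof -
      obtain \<alpha> \<beta> x y where s: "s = block (\<alpha> *\<^sub>C id_blinfun) x (y\<^sup>\<star>) (\<beta> *\<^sub>C id_blinfun)" and xy: "x \<in> X" "y \<in> X"
        using \<open>s \<in> S\<close> unfolding S_def paulsen_system_def by blast
      have xyT: "x \<in> T" "y \<in> T"
        using xy XT by auto
      show "V o\<^sub>L \<omega> s = \<omega> s o\<^sub>L V"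
        by (simp add: s \<omega>_block xyT V_diag block_comp intertwine scale)
      have "s\<^sup>\<star> = block (cnj \<alpha> *\<^sub>C id_blinfun) y (x\<^sup>\<star>) (cnj \<beta> *\<^sub>C id_blinfun)"
        using xyT by (simp add: s adj_block T_bops adj_scaleC)
      then show "s\<^sup>\<star> \<in> S"
        using paulsen_system_memI[OF xy(2,1)] by (simp add: S_def)
    qed
    have "V o\<^sub>L \<omega> a = \<omega> a o\<^sub>L V"
    proof (rule star_representation_commute_generated[OF S])
      show "V \<in> bops"
        using V by (simp add: isometry_def)
      show "id_blinfun \<in> cstar_generated S"
        using id SA by (auto simp: A_def)
    qed (use \<omega> comm a in \<open>auto simp: A_def\<close>)
    \<comment> \<open>Once \<open>V\<close> has been moved past \<open>\<omega> a\<close>, the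
      isometry relation removes it.\<close>
    then have "V\<^sup>\<star> o\<^sub>L \<omega> a o\<^sub>L V = V\<^sup>\<star> o\<^sub>L V o\<^sub>L \<omega> a"
      by (simp add: comp_assoc)
    then show ?thesis
      by (simp add: isometry_adj_comp[OF V])
  qed
  show ?thesis
    unfolding weak_boundary_star_representation_def irreducible_star_representation_def
      S_def[symmetric] A_def[symmetric]
    using \<omega>(1) irreducible unique by blast
qed

end
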